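(* Let $k\ge2$ and $F=F(a_1,\dots,a_k)$. For $\phi\in\mathrm{Out}(F)$ and $q\in\alpha(C)\subseteq Q(F)$ put $\tilde\phi(q):=\alpha(\phi(w))$, where $w\in C$ is any cyclic word with $\alpha(w)=q$. Then $\tilde\phi(q)$ is well-defined, and the map $\tilde\phi:\alpha(C)\to\alpha(C)$ is continuous in the topology induced from $Q(F)$. This map extends uniquely to a continuous map $\tilde\phi:Q(F)\to Q(F)$, which is a homeomorphism. The map $\mathrm{Out}(F)\to\mathrm{Homeo}(Q(F))$, $\phi\mapsto\tilde\phi$, defines a left action of $\mathrm{Out}(F)$ on $Q(F)$ by homeomorphisms.
   Context: Let $X=\{a_1,\dots,a_k\}^{\pm1}$; elements of $F$ are identified with freely reduced words over $X$, and $|v|$ is the word length. A cyclic word is an equivalence class of cyclically reduced words up to cyclic permutation; $C$ is the set of nontrivial cyclic words, identified with the set of nontrivial conjugacy classes of $F$, so $\mathrm{Out}(F)$ acts on $C$; $\|w\|$ is the length of a cyclic word $w$. For a nontrivial cyclic word $w$ represented by the cyclically reduced word $x_1\dots x_N$ ($x_i\in X$), extend $x_i$ to all $i\in\mathbb Z$ by $x_{i+N}=x_i$; for a freely reduced word $u$ of length $m\ge1$, $n_w(u)$ is the number of $i\in\{1,\dots,N\}$ with $x_ix_{i+1}\cdots x_{i+m-1}=u$ (here $m>N$ is allowed); $n_w(1)=\|w\|$; and $f_w(u)=n_w(u)/\|w\|$. For $m\ge1$ let $D(m)=2k(2k-1)^{m-1}$ be the number of elements of length $m$ in $F$; coordinates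 in $\mathbb R^{D(m)}$ are indexed by $v\in F$, $|v|=m$. $Q_m\subseteq\mathbb R^{D(m)}$ is the set of $q=(q_v)_{|v|=m}$ such that: (1) $\sum_{|v|=m}q_v=1$; (2) $q_v\ge0$ for all $v$; (3) for each $u\in F$ with $|u|=m-1$, $\sum_{x\in X,|ux|=m}q_{ux}=\sum_{y\in X,|yu|=m}q_{yu}$. Also $Q_0=\{1\}$. For $m\ge1$, $\pi_m:Q_m\to Q_{m-1}$ is given by $[\pi_m(q)]_u=\sum_{x\in X,|ux|=m}q_{ux}$ for $|u|=m-1$. The frequency space $Q(F)=\varprojlim(Q_m,\pi_m)$ is the inverse limit, with the inverse limit topology (subspace topology from $\prod_{m\ge0}Q_m$); its points are tuples $(q_v)_{v\in F}$. The map $\alpha:C\to Q(F)$ is $\alpha(w)=(f_w(v))_{v\in F}$. *)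

theory Defs
  imports "HOL-Analysis.Function_Topology" "HOL-Algebra.Group_Action"
begin

section \<open>The free group of rank \<open>k\<close> as the group of freely reduced words\<close>

text \<open>The pair \<open>(i, b)\<close> with \<open>i < k\<close> encodes the letter \<open>a\<^sub>i\<^sub>+\<^sub>1\<close> if \<open>b\<close> holds and its formal inverse
  otherwise.\<close>

type_synonym letter = "nat \<times> bool"
type_synonym word = "letter list"

definition letters :: "nat \<Rightarrow> letter set" where
  "letters k = {..<k} \<times> UNIV"

definition letter_inv :: "letter \<Rightarrow> letter" where
  "letter_inv x = (fst x, \<not> snd x)"

definition freely_reduced :: "word \<Rightarrow> bool" where
  "freely_reduced w \<longleftrightarrow> successively (\<lambda>x y. y \<noteq> letter_inv x) w"

definition reduced_words :: "nat \<Rightarrow> word set" where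
  "reduced_words k = {w \<in> lists (letters k). freely_reduced w}"

definition words :: "nat \<Rightarrow> nat \<Rightarrow> word set" where
  "words k m = {w \<in> reduced_words k. length w = m}"

definition cons_reduce :: "letter \<Rightarrow> word \<Rightarrow> word" where
  "cons_reduce x w = (if w \<noteq> [] \<and> hd w = letter_inv x then tl w else x # w)"

definition reduce :: "word \<Rightarrow> word" where
  "reduce w = foldr cons_reduce w []"

definition free_group :: "nat \<Rightarrow> word monoid" where
  "free_group k = \<lparr>carrier = reduced_words k, monoid.mult = (\<lambda>u v. reduce (u @ v)), one = []\<rparr>"

lemma letter_inv_letter_inv [simp]: "letter_inv (letter_inv x) = x"
  by (simp add: letter_inv_def)

lemma letter_inv_in_letters [simp]: "letter_inv x \<in> letters k \<longleftrightarrow> x \<in> letters k"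
  by (simp add: letter_inv_def letters_def mem_Times_iff)

lemma freely_reduced_Nil [simp]: "freely_reduced []"
  by (simp add: freely_reduced_def)

lemma freely_reduced_Cons:
  "freely_reduced (x # w) \<longleftrightarrow> (w = [] \<or> hd w \<noteq> letter_inv x) \<and> freely_reduced w"
  by (cases w) (auto simp: freely_reduced_def)

lemma freely_reduced_cons_reduce: "freely_reduced w \<Longrightarrow> freely_reduced (cons_reduce x w)"
  by (cases w) (auto simp: cons_reduce_def freely_reduced_Cons)

lemma cons_reduce_cancel: "freely_reduced w \<Longrightarrow> cons_reduce x (cons_reduce (letter_inv x) w) = w"
  by (cases w) (auto simp: cons_reduce_def freely_reduced_Cons)

lemma freely_reduced_foldr: "freely_reduced v \<Longrightarrow> freely_reduced (foldr cons_reduce u v)"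
  by (induction u) (auto simp: freely_reduced_cons_reduce)

lemma freely_reduced_reduce: "freely_reduced (reduce w)"
  by (simp add: reduce_def freely_reduced_foldr)

lemma reduce_ident: "freely_reduced w \<Longrightarrow> reduce w = w"
  by (induction w) (auto simp: reduce_def cons_reduce_def freely_reduced_Cons)

lemma reduce_in_lists: "w \<in> lists A \<Longrightarrow> reduce w \<in> lists A"
proof (induction w)
  case (Cons x w)
  then show ?case
    by (cases "reduce w") (auto simp: reduce_def cons_reduce_def)
qed (simp add: reduce_def)

lemma foldr_reduce: "freely_reduced v \<Longrightarrow> foldr cons_reduce (reduce u) v = foldr cons_reduce u v"
proof (induction u)
  case (Cons x u)
  have eq: "reduce (x # u) = cons_reduce x (reduce u)"
    by (simp add: reduce_def)
  have "foldr cons_reduce (cons_reduce x r) v = cons_reduce x (foldr cons_reduce r v)" for r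
  proof (cases "r \<noteq> [] \<and> hd r = letter_inv x")
    case True
    then obtain r' where "r = letter_inv x # r'"
      by (cases r) auto
    then show ?thesis
      using cons_reduce_cancel[OF freely_reduced_foldr[OF Cons.prems], of x r']
      by (simp add: cons_reduce_def[of x "letter_inv x # r'"])
  qed (auto simp: cons_reduce_def[of x r])
  with Cons eq show ?case by simp
qed (simp add: reduce_def)

lemma reduce_append: "reduce (u @ v) = foldr cons_reduce u (reduce v)"
  by (simp add: reduce_def)

lemma group_free_group: "group (free_group k)"
proof (rule groupI)
  fix u v w
  assume "u \<in> carrier (free_group k)" "v \<in> carrier (free_group k)" "w \<in> carrier (free_group k)"
  then have "freely_reduced w"
    by (auto simp: free_group_def reduced_words_def)
  then show "u \<otimes>\<^bsub>free_group k\<^esub> v \<otimes>\<^bsub>free_group k\<^esub> w = u \<otimes>\<^bsub>free_group k\<^esub> (v \<otimes>\<^bsub>free_group k\<^esub> w)"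
    by (simp add: free_group_def reduce_append foldr_reduce freely_reduced_foldr reduce_ident)
       (simp add: foldr_reduce freely_reduced_foldr reduce_ident flip: reduce_append foldr_append)
next
  fix u
  assume u: "u \<in> carrier (free_group k)"
  have "foldr cons_reduce (rev (map letter_inv u)) (foldr cons_reduce u w) = w"
    if "freely_reduced w" for w
    using that
  proof (induction u)
    case (Cons x u)
    then show ?case
      using cons_reduce_cancel[of "foldr cons_reduce u w" "letter_inv x"]
      by (simp add: freely_reduced_foldr)
  qed simp
  from this[of "[]"] have "reduce (reduce (rev (map letter_inv u)) @ u) = []"
    by (simp add: reduce_append foldr_reduce freely_reduced_reduce) (simp add: reduce_def)
  moreover have "reduce (rev (map letter_inv u)) \<in> reduced_words k"
  proof -
    have "rev (map letter_inv u) \<in> lists (letters k)"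
      using u by (auto simp: free_group_def reduced_words_def in_lists_conv_set
          simp del: split_paired_All)
    then show ?thesis
      by (simp add: reduced_words_def freely_reduced_reduce reduce_in_lists)
  qed
  ultimately show "\<exists>v\<in>carrier (free_group k). v \<otimes>\<^bsub>free_group k\<^esub> u = \<one>\<^bsub>free_group k\<^esub>"
    by (auto simp: free_group_def)
next
  fix u v
  assume "u \<in> carrier (free_group k)" "v \<in> carrier (free_group k)"
  then show "u \<otimes>\<^bsub>free_group k\<^esub> v \<in> carrier (free_group k)"
    by (simp add: free_group_def reduced_words_def freely_reduced_reduce reduce_in_lists)
qed (auto simp: free_group_def reduced_words_def reduce_ident)

section \<open>Outer automorphisms\<close>

text \<open>In \<^const>\<open>AutoGroup\<close> the product is composition, \<open>(\<phi> \<otimes> \<psi>) x = \<phi> (\<psi> x)\<close>; the elements of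
  \<open>Out G\<close> are the cosets of the inner automorphisms, that is, sets of automorphisms.\<close>

definition inner_auto :: "('a, 'b) monoid_scheme \<Rightarrow> ('a \<Rightarrow> 'a) set" where
  "inner_auto G = (\<lambda>g. \<lambda>x\<in>carrier G. g \<otimes>\<^bsub>G\<^esub> x \<otimes>\<^bsub>G\<^esub> inv\<^bsub>G\<^esub> g) ` carrier G"

definition Out :: "('a, 'b) monoid_scheme \<Rightarrow> ('a \<Rightarrow> 'a) set monoid" where
  "Out G = AutoGroup G Mod inner_auto G"

definition conj_class :: "('a, 'b) monoid_scheme \<Rightarrow> 'a \<Rightarrow> 'a set" where
  "conj_class G x = (\<lambda>g. g \<otimes>\<^bsub>G\<^esub> x \<otimes>\<^bsub>G\<^esub> inv\<^bsub>G\<^esub> g) ` carrier G"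

section \<open>Cyclic words\<close>

definition cyclically_reduced_words :: "nat \<Rightarrow> word set" where
  "cyclically_reduced_words k =
    {w \<in> reduced_words k. w \<noteq> [] \<longrightarrow> hd w \<noteq> letter_inv (last w)}"

definition cyclic_class :: "word \<Rightarrow> word set" where
  "cyclic_class w = range (\<lambda>n. rotate n w)"

definition cyclic_words :: "nat \<Rightarrow> word set set" where
  "cyclic_words k = cyclic_class ` (cyclically_reduced_words k - {[]})"

text \<open>A cyclic word \<open>c\<close> corresponds to the conjugacy class containing its representatives, and a
  conjugacy class to the set of cyclically reduced words in it.  Transporting the action
  \<open>[\<phi>] \<cdot> [w] = [\<phi> w]\<close> on conjugacy classes along this identification gives the following.\<close>

definition cyclic_act :: "nat \<Rightarrow> (word \<Rightarrow> word) set \<Rightarrow> word set \<Rightarrow> word set" where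
  "cyclic_act k \<Phi> c =
    (\<Union>\<phi>\<in>\<Phi>. \<Union>w\<in>c. conj_class (free_group k) (\<phi> w)) \<inter> cyclically_reduced_words k"

definition occurrences :: "word \<Rightarrow> word \<Rightarrow> nat" where
  "occurrences x u =
    card {i. i < length x \<and> (\<forall>j<length u. x ! ((i + j) mod length x) = u ! j)}"

text \<open>The quantities below do not depend on the chosen representative.  For the empty word \<open>u\<close> the
  definition gives \<open>n\<^sub>w(1) = \<parallel>w\<parallel>\<close>.\<close>

definition cyclic_length :: "word set \<Rightarrow> nat" where
  "cyclic_length c = length (SOME x. x \<in> c)"

definition cyclic_occ :: "word set \<Rightarrow> word \<Rightarrow> nat" where
  "cyclic_occ c u = occurrences (SOME x. x \<in> c) u"

definition frequency :: "word set \<Rightarrow> word \<Rightarrow> real" where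
  "frequency c u = real (cyclic_occ c u) / real (cyclic_length c)"

section \<open>The frequency space\<close>

text \<open>A vector of \<open>\<real>\<^sup>D\<close> with \<open>D = D(m)\<close> is a function that is extensional on \<^term>\<open>words k m\<close>.\<close>

definition Qset :: "nat \<Rightarrow> nat \<Rightarrow> (word \<Rightarrow> real) set" where
  "Qset k m =
    (if m = 0 then {\<lambda>v\<in>words k 0. 1}
     else {q \<in> extensional (words k m).
            (\<Sum>v\<in>words k m. q v) = 1 \<and>
            (\<forall>v\<in>words k m. 0 \<le> q v) \<and>
            (\<forall>u\<in>words k (m - 1).
              (\<Sum>x | x \<in> letters k \<and> u @ [x] \<in> words k m. q (u @ [x])) =
              (\<Sum>y | y \<in> letters k \<and> y # u \<in> words k m. q (y # u)))})"

definition Qproj :: "nat \<Rightarrow> nat \<Rightarrow> (word \<Rightarrow> real) \<Rightarrow> (word \<Rightarrow> real)" where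
  "Qproj k m q =
    (\<lambda>u\<in>words k (m - 1). \<Sum>x | x \<in> letters k \<and> u @ [x] \<in> words k m. q (u @ [x]))"

definition Qtop :: "nat \<Rightarrow> nat \<Rightarrow> (word \<Rightarrow> real) topology" where
  "Qtop k m = subtopology (product_topology (\<lambda>v. euclideanreal) (words k m)) (Qset k m)"

definition freq_space :: "nat \<Rightarrow> (nat \<Rightarrow> word \<Rightarrow> real) topology" where
  "freq_space k =
    subtopology (product_topology (Qtop k) UNIV) {q. \<forall>m\<ge>1. Qproj k m (q m) = q (m - 1)}"

definition freq_map :: "nat \<Rightarrow> word set \<Rightarrow> (nat \<Rightarrow> word \<Rightarrow> real)" where
  "freq_map k c = (\<lambda>m. \<lambda>v\<in>words k m. frequency c v)"

section \<open>The induced maps\<close>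

definition tilde :: "nat \<Rightarrow> (word \<Rightarrow> word) set \<Rightarrow> (nat \<Rightarrow> word \<Rightarrow> real) \<Rightarrow> (nat \<Rightarrow> word \<Rightarrow> real)"
  where
  "tilde k \<Phi> q = freq_map k (cyclic_act k \<Phi> (SOME w. w \<in> cyclic_words k \<and> freq_map k w = q))"

text \<open>Maps on \<open>Q(F)\<close> are represented by extensional functions, as required by \<^const>\<open>BijGroup\<close>
  and for uniqueness.\<close>

definition continuous_extension ::
  "nat \<Rightarrow> (word \<Rightarrow> word) set \<Rightarrow> ((nat \<Rightarrow> word \<Rightarrow> real) \<Rightarrow> (nat \<Rightarrow> word \<Rightarrow> real)) \<Rightarrow> bool" where
  "continuous_extension k \<Phi> g \<longleftrightarrow>
    g \<in> extensional (topspace (freq_space k)) \<and>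
    continuous_map (freq_space k) (freq_space k) g \<and>
    (\<forall>q \<in> freq_map k ` cyclic_words k. g q = tilde k \<Phi> q)"

definition tilde_ext ::
  "nat \<Rightarrow> (word \<Rightarrow> word) set \<Rightarrow> (nat \<Rightarrow> word \<Rightarrow> real) \<Rightarrow> (nat \<Rightarrow> word \<Rightarrow> real)" where
  "tilde_ext k \<Phi> = (THE g. continuous_extension k \<Phi> g)"

end

theory Submission
  imports Defs "HOL-Library.Sublist" "HOL-Analysis.Abstract_Topological_Spaces"
begin

text \<open>For a word \<open>v\<close>, the number of occurrences of \<open>v\<close> in \<open>g\<^sup>n\<close> grows linearly in \<open>n\<close>, and the
  rate \<open>asym_occ k v g\<close> depends only on the conjugacy class of \<open>g\<close>; for a cyclically reduced word
  \<open>w\<close> it is \<open>n\<^sub>w(v)\<close>.  By bounded cancellation, prepending a letter to \<open>g\<close> changes the number of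
  occurrences of \<open>v\<close> in \<open>\<phi> g\<close> by an amount that depends only on an initial segment of bounded
  length.  Hence the rates of \<open>\<phi> g\<close> are fixed finite linear combinations of the rates of \<open>g\<close>, so
  \<open>\<phi>\<close> acts on frequencies by quotients of linear functionals, and this formula makes sense on all
  of \<open>Q(F)\<close>: the denominator is bounded away from zero because \<open>\<phi>\<close> has a Lipschitz inverse.
  Everything else follows from the density of \<open>\<alpha>(C)\<close>: a point of \<open>Q\<^sub>m\<close> is a balanced flow on a finite
  graph, thus a nonnegative combination of cycles, and it is approximated by concatenating high
  powers of the corresponding cyclic words.\<close>

section \<open>Words in the free group\<close>

text \<open>Cyclic counts do not transform well under an automorphism: the image of a cyclically
  reduced word need not be cyclically reduced, and how much of it cancels depends on the whole word.
  Powers remove the difficulty, because conjugations, junctions and ends cost an error that does not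
  grow with the exponent. So counting is done with non-cyclic occurrences up to bounded error, and a
  cyclic word enters through its conjugacy class. The quotients come from normalisation: rates
  transform linearly, but frequencies are rates scaled to total mass one, so the action on them is
  projective. That the quotients satisfy the conditions defining \<open>Q(F)\<close> is not
  computed: each condition is closed and involves finitely many coordinates, so it passes from the
  dense set \<alpha>(C) to its closure. Density rests on gluing cycles that may lie in different
  parts of the graph. With at least four letters, one letter always joins two given reduced words;
  in rank one \<open>Q(F)\<close> is a segment and \<alpha>(C) consists of its two end
  points.\<close>

lemma (in group) inv_cancel:
  assumes "x \<in> carrier G" "y \<in> carrier G"
  shows "inv x \<otimes> (x \<otimes> y) = y" "x \<otimes> (inv x \<otimes> y) = y"
  using assms by (simp_all flip: m_assoc)

lemma mult_free_group: "u \<otimes>\<^bsub>free_group k\<^esub> v = reduce (u @ v)"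
  and carrier_free_group [simp]: "carrier (free_group k) = reduced_words k"
  and one_free_group: "\<one>\<^bsub>free_group k\<^esub> = []"
  by (simp_all add: free_group_def)

lemma freely_reduced_append:
  "freely_reduced (u @ v) \<longleftrightarrow>
    freely_reduced u \<and> freely_reduced v \<and> (u = [] \<or> v = [] \<or> hd v \<noteq> letter_inv (last u))"
  by (auto simp: freely_reduced_def successively_append_iff)

lemma reduced_words_append:
  "u @ v \<in> reduced_words k \<longleftrightarrow>
    u \<in> reduced_words k \<and> v \<in> reduced_words k \<and> (u = [] \<or> v = [] \<or> hd v \<noteq> letter_inv (last u))"
  by (auto simp: reduced_words_def freely_reduced_append)

lemma reduced_words_Cons:
  "x # v \<in> reduced_words k \<longleftrightarrow>
    x \<in> letters k \<and> v \<in> reduced_words k \<and> (v = [] \<or> hd v \<noteq> letter_inv x)"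
  by (auto simp: reduced_words_def freely_reduced_Cons)

lemma reduced_words_Nil [simp]: "[] \<in> reduced_words k"
  by (simp add: reduced_words_def)

lemma reduced_wordsD: "w \<in> reduced_words k \<Longrightarrow> freely_reduced w"
  by (simp add: reduced_words_def)

definition word_inv :: "word \<Rightarrow> word" where
  "word_inv w = rev (map letter_inv w)"

lemma word_inv_simps [simp]:
  "word_inv [] = []" "word_inv (x # w) = word_inv w @ [letter_inv x]"
  "word_inv (u @ v) = word_inv v @ word_inv u" "length (word_inv w) = length w"
  by (simp_all add: word_inv_def)

lemma word_inv_word_inv [simp]: "word_inv (word_inv w) = w"
  by (induction w) auto

lemma word_inv_eq_Nil [simp]: "word_inv w = [] \<longleftrightarrow> w = []"
  by (simp add: word_inv_def)

lemma last_word_inv: "w \<noteq> [] \<Longrightarrow> last (word_inv w) = letter_inv (hd w)"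
  by (simp add: word_inv_def last_rev hd_map)

lemma word_inv_in_reduced_words: "w \<in> reduced_words k \<Longrightarrow> word_inv w \<in> reduced_words k"
  by (induction w) (auto simp: reduced_words_append reduced_words_Cons last_word_inv)

lemma foldr_cons_reduce_word_inv:
  "freely_reduced w \<Longrightarrow> foldr cons_reduce (word_inv u) (foldr cons_reduce u w) = w"
proof (induction u)
  case (Cons x u)
  then show ?case
    using cons_reduce_cancel[of "foldr cons_reduce u w" "letter_inv x"]
    by (simp add: freely_reduced_foldr)
qed simp

lemma reduce_word_inv_append: "reduce (word_inv w @ w) = []"
  using foldr_cons_reduce_word_inv[of "[]" w] by (simp add: reduce_def)

lemma inv_free_group: "w \<in> reduced_words k \<Longrightarrow> inv\<^bsub>free_group k\<^esub> w = word_inv w"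
  by (rule group.inv_equality[OF group_free_group])
     (simp_all add: mult_free_group one_free_group reduce_word_inv_append word_inv_in_reduced_words)

lemma free_group_closed [simp]:
  "u \<in> reduced_words k \<Longrightarrow> v \<in> reduced_words k \<Longrightarrow> u \<otimes>\<^bsub>free_group k\<^esub> v \<in> reduced_words k"
  "u \<in> reduced_words k \<Longrightarrow> inv\<^bsub>free_group k\<^esub> u \<in> reduced_words k"
  "u \<in> reduced_words k \<Longrightarrow> u [^]\<^bsub>free_group k\<^esub> (n::nat) \<in> reduced_words k"
  using monoid.m_closed[OF group.is_monoid[OF group_free_group], of u k v]
    group.inv_closed[OF group_free_group, of u k]
    monoid.nat_pow_closed[OF group.is_monoid[OF group_free_group], of u k n]
  by simp_all

lemma free_group_cancel [simp]:
  assumes "u \<in> reduced_words k" "v \<in> reduced_words k"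
  shows "inv\<^bsub>free_group k\<^esub> u \<otimes>\<^bsub>free_group k\<^esub> (u \<otimes>\<^bsub>free_group k\<^esub> v) = v"
    and "u \<otimes>\<^bsub>free_group k\<^esub> (inv\<^bsub>free_group k\<^esub> u \<otimes>\<^bsub>free_group k\<^esub> v) = v"
  using group.inv_cancel[OF group_free_group, of u k v] assms by simp_all

text \<open>Induction on \<open>a\<close>. A new first letter of \<open>a\<close> can cancel only
  when \<open>p\<close> is empty, since otherwise it stands next to \<open>hd p\<close> inside the
  reduced word \<open>a\<close>; it then joins \<open>c\<close> and takes one letter from
  \<open>s\<close>.\<close>

lemma cancellation:
  assumes "freely_reduced a" "freely_reduced b"
  obtains p c s where "a = p @ c" "b = word_inv c @ s" "reduce (a @ b) = p @ s" "freely_reduced (p @ s)"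
proof -
  have "\<exists>p c s. a = p @ c \<and> b = word_inv c @ s \<and> reduce (a @ b) = p @ s"
    using assms
  proof (induction a)
    case Nil
    then show ?case by (auto simp: reduce_ident)
  next
    case (Cons x a)
    then obtain p c s where *: "a = p @ c" "b = word_inv c @ s" "reduce (a @ b) = p @ s"
      by (auto simp: freely_reduced_Cons)
    have red: "reduce ((x # a) @ b) = cons_reduce x (p @ s)"
      using * by (simp add: reduce_def)
    show ?case
    proof (cases "p @ s \<noteq> [] \<and> hd (p @ s) = letter_inv x")
      case True
      then have "p = []"
        using Cons.prems * by (cases p) (auto simp: freely_reduced_Cons)
      with True obtain s' where "s = letter_inv x # s'"
        by (cases s) auto
      then have "x # a = [] @ (x # c) \<and> b = word_inv (x # c) @ s' \<and> reduce ((x # a) @ b) = [] @ s'"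
        using * red \<open>p = []\<close> by (simp add: cons_reduce_def)
      then show ?thesis by blast
    next
      case False
      then have "x # a = (x # p) @ c \<and> b = word_inv c @ s \<and> reduce ((x # a) @ b) = (x # p) @ s"
        using * red by (auto simp: cons_reduce_def)
      then show ?thesis by blast
    qed
  qed
  then show ?thesis
    using that by (metis freely_reduced_reduce)
qed

section \<open>Occurrences of a factor\<close>

text \<open>Counts starting positions without wrapping around, the end of \<open>g\<close> included.
  The empty word therefore gets \<open>length g + 1\<close>, a shift that vanishes in the
  rates.\<close>

primrec occ :: "word \<Rightarrow> word \<Rightarrow> nat" where
  "occ v [] = of_bool (v = [])"
| "occ v (x # g) = occ v g + of_bool (prefix v (x # g))"

lemma occ_Nil [simp]: "occ [] g = Suc (length g)"
  by (induction g) auto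

lemma prefix_append_short: "length v \<le> length u \<Longrightarrow> prefix v (u @ s) \<longleftrightarrow> prefix v u"
  by (meson prefix_length_prefix prefix_order.trans prefixI)

text \<open>An occurrence of \<open>v\<close> meeting both \<open>a\<close> and \<open>s\<close>
  would contain all of \<open>q\<close> and at least two further letters, which the length bound
  excludes. Left and right contexts of \<open>q\<close> thus contribute independently.\<close>

lemma occ_append_overlap:
  assumes "length v \<le> Suc (length q)"
  shows "occ v (a @ q @ s) + occ v q = occ v (a @ q) + occ v (q @ s)"
proof (induction a)
  case (Cons x a)
  have "prefix v ((x # a @ q) @ s) \<longleftrightarrow> prefix v (x # a @ q)"
    using assms by (intro prefix_append_short) simp
  with Cons show ?case by simp
qed simp

lemma occ_snoc: "occ v (g @ [x]) = occ v g + of_bool (suffix v (g @ [x]))"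
proof (induction g)
  case Nil
  show ?case
    by (cases v) (auto simp: suffix_def Cons_eq_append_conv)
next
  case (Cons y g)
  show ?case
  proof (cases "length v \<le> Suc (length g)")
    case True
    then have "prefix v ((y # g) @ [x]) \<longleftrightarrow> prefix v (y # g)"
      by (intro prefix_append_short) simp
    moreover have "suffix v ((y # g) @ [x]) \<longleftrightarrow> suffix v (g @ [x])"
      using True by (auto simp: suffix_Cons)
    ultimately show ?thesis using Cons by simp
  next
    case False
    then have "\<not> prefix v (y # g)" "\<not> suffix v (g @ [x])"
      using prefix_length_le suffix_length_le by fastforce+
    moreover have "prefix v (y # g @ [x]) \<longleftrightarrow> v = y # g @ [x]"
    proof
      assume "prefix v (y # g @ [x])"
      then obtain zs where zs: "y # g @ [x] = v @ zs"
        by (rule prefixE)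
      have "length v + length zs = length g + 2"
        using arg_cong[OF zs, of length] by simp
      with False have "length zs = 0" by linarith
      with zs show "v = y # g @ [x]" by simp
    qed simp
    moreover have "suffix v (y # g @ [x]) \<longleftrightarrow> v = y # g @ [x]"
      using False \<open>\<not> suffix v (g @ [x])\<close> by (auto simp: suffix_Cons)
    ultimately show ?thesis using Cons by simp
  qed
qed

lemma occ_append: "\<bar>real (occ v (a @ b)) - occ v a - occ v b\<bar> \<le> length v + 1"
proof -
  \<comment> \<open>The minimum makes the induction work: once the left word is at least as long as
    \<open>v\<close>, a further letter in front starts no occurrence that reaches into
    \<open>b\<close>. The additive 1 is for empty \<open>v\<close>.\<close>
  have "\<bar>real (occ v (a @ b)) - occ v a - occ v b\<bar> \<le> min (length a) (length v) + 1"
  proof (induction a)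
    case (Cons x a)
    show ?case
    proof (cases "length v \<le> Suc (length a)")
      case True
      then have "prefix v ((x # a) @ b) \<longleftrightarrow> prefix v (x # a)"
        by (intro prefix_append_short) simp
      with Cons show ?thesis by simp
    next
      case False
      then have "\<not> prefix v (x # a)"
        using prefix_length_le by fastforce
      then show ?thesis
        using False Cons by (auto split: if_splits simp: abs_le_iff)
    qed
  qed simp
  then show ?thesis by linarith
qed

lemma occ_append_left: "\<bar>real (occ v (a @ b)) - occ v b\<bar> \<le> length a"
  by (induction a) auto

lemma occ_append_right: "\<bar>real (occ v (b @ a)) - occ v b\<bar> \<le> length a"
proof (induction a rule: rev_induct)
  case (snoc x a)
  then show ?case
    using occ_snoc[of v "b @ a" x] by (cases "suffix v (b @ a @ [x])") auto
qed simp

text \<open>Passing from \<open>word_inv c @ s\<close> to \<open>p @ s\<close> removes a prefix of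
  the length of \<open>c\<close> and adds one of the length of \<open>p\<close>, together
  \<open>length a\<close>; the other side is symmetric.\<close>

lemma occ_reduce_append:
  assumes "freely_reduced a" "freely_reduced b"
  shows "\<bar>real (occ v (reduce (a @ b))) - occ v b\<bar> \<le> length a"
    and "\<bar>real (occ v (reduce (a @ b))) - occ v a\<bar> \<le> length b"
proof -
  obtain p c s where *: "a = p @ c" "b = word_inv c @ s" "reduce (a @ b) = p @ s"
    using cancellation[OF assms] by metis
  show "\<bar>real (occ v (reduce (a @ b))) - occ v b\<bar> \<le> length a"
    using occ_append_left[of v p s] occ_append_left[of v "word_inv c" s] unfolding *(3) unfolding *(1,2) by simp
  show "\<bar>real (occ v (reduce (a @ b))) - occ v a\<bar> \<le> length b"
    using occ_append_right[of v p s] occ_append_right[of v p c] unfolding *(3) unfolding *(1,2) by simp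
qed

section \<open>Occurrences in periodic words\<close>

lemma occ_eq_card:
  "occ v g = card {i. i + length v \<le> length g \<and> (\<forall>j<length v. g ! (i + j) = v ! j)}"
proof (induction g)
  case Nil
  have "{i. i + length v \<le> 0 \<and> (\<forall>j<length v. ([]::word) ! (i + j) = v ! j)} = (if v = [] then {0} else {})"
    by auto
  then show ?case by simp
next
  case (Cons x g)
  let ?S = "\<lambda>g. {i. i + length v \<le> length g \<and> (\<forall>j<length v. g ! (i + j) = v ! j)}"
  have fin: "finite (?S g)" for g
    by (rule finite_subset[of _ "{..length g}"]) auto
  have pre: "prefix v (x # g) \<longleftrightarrow> 0 \<in> ?S (x # g)"
  proof -
    have "prefix v (x # g) \<longleftrightarrow> length v \<le> length (x # g) \<and> take (length v) (x # g) = v"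
      by (metis append_eq_conv_conj prefix_def prefix_length_le take_is_prefix)
    also have "\<dots> \<longleftrightarrow> 0 \<in> ?S (x # g)"
      by (auto simp: list_eq_iff_nth_eq)
    finally show ?thesis .
  qed
  have "?S (x # g) = Suc ` ?S g \<union> (if prefix v (x # g) then {0} else {})"
  proof (rule Set.set_eqI)
    fix i show "i \<in> ?S (x # g) \<longleftrightarrow> i \<in> Suc ` ?S g \<union> (if prefix v (x # g) then {0} else {})"
      by (cases i) (auto simp: pre image_iff)
  qed
  then have "card (?S (x # g)) = card (Suc ` ?S g) + of_bool (prefix v (x # g))"
    by (auto simp: card_Un_disjoint fin)
  with Cons show ?case by (simp add: card_image)
qed

lemma nth_concat_replicate:
  "l < n * length w \<Longrightarrow> concat (replicate n w) ! l = w ! (l mod length w)"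
proof (induction n arbitrary: l)
  case (Suc n)
  show ?case
  proof (cases "l < length w")
    case False
    then have "l - length w < n * length w"
      using Suc.prems by auto
    then show ?thesis
      using Suc.IH[of "l - length w"] False by (simp add: nth_append le_mod_geq)
  qed (simp add: nth_append)
qed simp

lemma card_periodic:
  assumes "N > 0"
  shows "card {i. i < n * N \<and> P (i mod N)} = n * card {i. i < N \<and> P i}"
proof (induction n)
  case (Suc n)
  have "{i. i < Suc n * N \<and> P (i mod N)} =
      {i. i < n * N \<and> P (i mod N)} \<union> (\<lambda>i. n * N + i) ` {i. i < N \<and> P i}" (is "?L = ?A \<union> ?B")
  proof (rule Set.set_eqI)
    fix i show "i \<in> ?L \<longleftrightarrow> i \<in> ?A \<union> ?B"
    proof (cases "i < n * N")
      case False
      define j where "j = i - n * N"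
      have i: "i = n * N + j"
        using False by (simp add: j_def)
      show ?thesis
        unfolding i by (auto simp: image_iff)
    qed (auto simp: image_iff)
  qed
  moreover have "card (?A \<union> ?B) = card ?A + card ?B"
    by (rule card_Un_disjoint) auto
  moreover have "card ?B = card {i. i < N \<and> P i}"
    by (rule card_image) auto
  ultimately show ?case using Suc by simp
qed simp

lemma occ_power:
  assumes "w \<noteq> []"
  shows "\<bar>real (occ v (concat (replicate n w))) - real n * occurrences w v\<bar> \<le> length v + 1"
proof -
  let ?N = "length w" and ?m = "length v" and ?g = "concat (replicate n w)"
  have len: "length ?g = n * ?N"
    by (induction n) auto
  define A where "A = {i. i + ?m \<le> length ?g \<and> (\<forall>j<?m. ?g ! (i + j) = v ! j)}"
  define B where "B = {i. i < n * ?N \<and> (\<forall>j<?m. w ! ((i + j) mod ?N) = v ! j)}"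
  have "card B = card {i. i < n * ?N \<and> (\<forall>j<?m. w ! ((i mod ?N + j) mod ?N) = v ! j)}"
    unfolding B_def by (simp add: mod_add_left_eq)
  also have "\<dots> = n * occurrences w v"
    unfolding occurrences_def
    by (rule card_periodic[where P = "\<lambda>i. \<forall>j<?m. w ! ((i + j) mod ?N) = v ! j"]) (use assms in simp)
  finally have cB: "card B = n * occurrences w v" .
  have fin: "finite A" "finite B"
    unfolding A_def B_def
    by (auto intro: finite_subset[of _ "{..length ?g}"])
  have nth: "?g ! (i + j) = w ! ((i + j) mod ?N)" if "i + ?m \<le> length ?g" "j < ?m" for i j
    using that len by (intro nth_concat_replicate) simp
  \<comment> \<open>The end position \<open>n * ?N\<close> is counted by \<open>occ\<close> only for
    empty \<open>v\<close>; cyclic positions stop before it.\<close>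
  have "A \<subseteq> B \<union> {n * ?N}"
    using nth by (auto simp: A_def B_def len)
  then have "card A \<le> card (B \<union> {n * ?N})"
    using fin by (intro card_mono) auto
  also have "\<dots> \<le> card B + 1"
    using card_Un_le[of B "{n * ?N}"] by simp
  finally have 1: "card A \<le> card B + 1" .
  \<comment> \<open>Cyclic occurrences missing from \<open>A\<close> run past the end of the word,
    so they start among its last \<open>?m\<close> positions.\<close>
  have "B \<subseteq> A \<union> {n * ?N - ?m..<n * ?N}"
    using nth by (auto simp: A_def B_def len)
  then have "card B \<le> card (A \<union> {n * ?N - ?m..<n * ?N})"
    using fin by (intro card_mono) auto
  also have "\<dots> \<le> card A + card {n * ?N - ?m..<n * ?N}"
    by (rule card_Un_le)
  also have "\<dots> \<le> card A + ?m"
    by simp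
  finally have 2: "card B \<le> card A + ?m" .
  have "occ v ?g = card A"
    by (simp add: occ_eq_card A_def)
  moreover have "real n * occurrences w v = card B"
    using cB by simp
  ultimately show ?thesis
    using 1 2 by simp
qed

section \<open>Asymptotic occurrence rates\<close>

lemma letter_inv_neq: "letter_inv x \<noteq> x"
  by (cases x) (simp add: letter_inv_def)

text \<open>Cyclic reducedness excludes cancellation where two copies of \<open>w\<close> meet, so
  group powers are plain repetitions.\<close>

lemma cyclic_powers:
  assumes "w \<in> cyclically_reduced_words k"
  shows "concat (replicate n w) \<in> reduced_words k"
    and "w [^]\<^bsub>free_group k\<^esub> n = concat (replicate n w)"
proof -
  have w: "w \<in> reduced_words k" "w \<noteq> [] \<Longrightarrow> hd w \<noteq> letter_inv (last w)"
    using assms by (auto simp: cyclically_reduced_words_def)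
  show red: "concat (replicate n w) \<in> reduced_words k" for n
  proof (induction n)
    case (Suc n)
    have "hd (concat (replicate n w)) = hd w" if "concat (replicate n w) \<noteq> []"
      using that by (cases n) (auto simp: hd_append)
    with Suc w show ?case
      by (auto simp: reduced_words_append)
  qed simp
  have snoc: "concat (replicate n w) @ w = concat (replicate (Suc n) w)" for n
    by (induction n) auto
  show "w [^]\<^bsub>free_group k\<^esub> n = concat (replicate n w)"
  proof (induction n)
    case (Suc n)
    then show ?case
      using red[of "Suc n"]
      by (simp only: nat_pow_Suc mult_free_group snoc reduce_ident reduced_wordsD)
  qed (simp add: one_free_group)
qed

text \<open>If the first and last letters are inverse to each other, strip both and recurse. They
  are different positions because no letter is its own inverse.\<close>

lemma conj_cyclically_reduced:
  assumes "g \<in> reduced_words k"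
  shows "\<exists>a\<in>reduced_words k. \<exists>w\<in>cyclically_reduced_words k.
    g = a \<otimes>\<^bsub>free_group k\<^esub> w \<otimes>\<^bsub>free_group k\<^esub> inv\<^bsub>free_group k\<^esub> a"
  using assms
proof (induction g rule: length_induct)
  case (1 g)
  interpret F: group "free_group k" by (rule group_free_group)
  show ?case
  proof (cases "g \<in> cyclically_reduced_words k")
    case True
    then have "g = [] \<otimes>\<^bsub>free_group k\<^esub> g \<otimes>\<^bsub>free_group k\<^esub> inv\<^bsub>free_group k\<^esub> []"
      using 1 by (simp add: mult_free_group inv_free_group reduce_ident reduced_wordsD)
    with True show ?thesis by (metis reduced_words_Nil)
  next
    case False
    with 1 have "g \<noteq> []" "hd g = letter_inv (last g)"
      by (auto simp: cyclically_reduced_words_def)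
    moreover have "length g \<noteq> 1"
    proof
      assume "length g = 1"
      then obtain x where "g = [x]"
        by (auto simp: length_Suc_conv)
      with \<open>hd g = _\<close> show False
        using letter_inv_neq[of x] by simp
    qed
    ultimately obtain x y m where g: "g = x # m @ [y]"
      by (metis One_nat_def append_Nil hd_Cons_tl length_Cons list.size(3) rev_exhaust append_Cons)
    with \<open>hd g = letter_inv (last g)\<close> have y: "y = letter_inv x" by simp
    have red: "x # m @ [y] \<in> reduced_words k" "x # m \<in> reduced_words k" "m \<in> reduced_words k"
        "[x] \<in> reduced_words k"
      using 1 reduced_words_append[of "x # m" "[y]" k] reduced_words_append[of "[x]" m k] by (auto simp: g)
    then obtain b w where b: "b \<in> reduced_words k" "w \<in> cyclically_reduced_words k"
        "m = b \<otimes>\<^bsub>free_group k\<^esub> w \<otimes>\<^bsub>free_group k\<^esub> inv\<^bsub>free_group k\<^esub> b"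
      using 1(1)[rule_format, of m] by (auto simp: g)
    then have w: "w \<in> reduced_words k"
      by (simp add: cyclically_reduced_words_def)
    let ?a = "[x] \<otimes>\<^bsub>free_group k\<^esub> b"
    have "g = [x] \<otimes>\<^bsub>free_group k\<^esub> m \<otimes>\<^bsub>free_group k\<^esub> inv\<^bsub>free_group k\<^esub> [x]"
      using red by (simp add: g y mult_free_group inv_free_group reduce_ident reduced_wordsD)
    also have "\<dots> = ?a \<otimes>\<^bsub>free_group k\<^esub> w \<otimes>\<^bsub>free_group k\<^esub> inv\<^bsub>free_group k\<^esub> ?a"
      using red b w by (simp add: F.m_assoc F.inv_mult_group)
    finally show ?thesis
      using b red F.m_closed[of "[x]" b] by (intro bexI[of _ ?a] bexI[of _ w]) simp_all
  qed
qed

lemma tendsto_div_of_bounded_error: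
  assumes "\<And>n. \<bar>f n - real n * r\<bar> \<le> C"
  shows "(\<lambda>n. f n / real n) \<longlonglongrightarrow> r"
proof -
  have "(\<lambda>n. f n / real n - r) \<longlonglongrightarrow> 0"
  proof (rule tendsto_0_le[where K = 1])
    show "\<forall>\<^sub>F n in sequentially. norm (f n / real n - r) \<le> norm (C / real n) * 1"
    proof (rule eventually_sequentiallyI[of 1])
      fix n :: nat assume "1 \<le> n"
      then have "f n / real n - r = (f n - real n * r) / real n"
        by (simp add: field_simps)
      then show "norm (f n / real n - r) \<le> norm (C / real n) * 1"
        using assms[of n] by (simp add: divide_right_mono)
    qed
  qed (rule lim_const_over_n)
  then show ?thesis by (simp add: LIM_zero_iff)
qed

text \<open>For nontrivial \<open>g\<close>, this is the number of occurrences of \<open>v\<close>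
  along one period of the axis of \<open>g\<close> in the Cayley tree. Existence of the limit, with
  an error bounded in \<open>n\<close>, is \<open>asym_occ_exists\<close>.\<close>

definition asym_occ :: "nat \<Rightarrow> word \<Rightarrow> word \<Rightarrow> real" where
  "asym_occ k v g = lim (\<lambda>n. real (occ v (g [^]\<^bsub>free_group k\<^esub> n)) / real n)"

lemma asym_occ_eqI:
  assumes "\<And>n. \<bar>real (occ v (g [^]\<^bsub>free_group k\<^esub> n)) - real n * r\<bar> \<le> C"
  shows "asym_occ k v g = r"
  unfolding asym_occ_def using tendsto_div_of_bounded_error[OF assms] by (rule limI)

lemma conj_pow:
  assumes "a \<in> reduced_words k" "g \<in> reduced_words k"
  shows "(a \<otimes>\<^bsub>free_group k\<^esub> g \<otimes>\<^bsub>free_group k\<^esub> inv\<^bsub>free_group k\<^esub> a) [^]\<^bsub>free_group k\<^esub> (n::nat) =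
    a \<otimes>\<^bsub>free_group k\<^esub> g [^]\<^bsub>free_group k\<^esub> n \<otimes>\<^bsub>free_group k\<^esub> inv\<^bsub>free_group k\<^esub> a"
proof -
  interpret F: group "free_group k" by (rule group_free_group)
  show ?thesis
  proof (induction n)
    case 0
    then show ?case using assms by simp
  next
    case (Suc n)
    with Suc assms show ?case
      by (simp add: F.m_assoc)
  qed
qed

text \<open>Conjugation commutes with powers, so just two multiplications, by \<open>a\<close> and
  by its inverse, separate the counts; hence the bound is uniform in \<open>n\<close>.\<close>

lemma occ_conj_pow:
  assumes "a \<in> reduced_words k" "g \<in> reduced_words k"
  shows "\<bar>real (occ v ((a \<otimes>\<^bsub>free_group k\<^esub> g \<otimes>\<^bsub>free_group k\<^esub> inv\<^bsub>free_group k\<^esub> a) [^]\<^bsub>free_group k\<^esub> (n::nat))) -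
    occ v (g [^]\<^bsub>free_group k\<^esub> n)\<bar> \<le> 2 * length a"
proof -
  let ?p = "g [^]\<^bsub>free_group k\<^esub> n"
  have "\<bar>real (occ v (reduce (a @ ?p))) - occ v ?p\<bar> \<le> length a"
    using assms by (intro occ_reduce_append) (auto simp: reduced_wordsD[of _ k])
  moreover have "\<bar>real (occ v (reduce (reduce (a @ ?p) @ word_inv a))) - occ v (reduce (a @ ?p))\<bar>
      \<le> length (word_inv a)"
    using assms by (intro occ_reduce_append)
      (auto simp: freely_reduced_reduce reduced_wordsD[of _ k] word_inv_in_reduced_words)
  ultimately show ?thesis
    unfolding conj_pow[OF assms] using assms by (simp add: mult_free_group inv_free_group)
qed

lemma asym_occ_exists:
  assumes "g \<in> reduced_words k"
  shows "\<exists>r C. 0 \<le> r \<and> (\<forall>n. \<bar>real (occ v (g [^]\<^bsub>free_group k\<^esub> n)) - real n * r\<bar> \<le> C)"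
proof -
  obtain a w where aw: "a \<in> reduced_words k" "w \<in> cyclically_reduced_words k"
    and g: "g = a \<otimes>\<^bsub>free_group k\<^esub> w \<otimes>\<^bsub>free_group k\<^esub> inv\<^bsub>free_group k\<^esub> a"
    using conj_cyclically_reduced[OF assms] by blast
  define r where "r = (if w = [] then 0 else occurrences w v)"
  have "\<bar>real (occ v (g [^]\<^bsub>free_group k\<^esub> n)) - real n * r\<bar> \<le> 2 * length a + length v + 1" for n
  proof -
    have "\<bar>real (occ v (w [^]\<^bsub>free_group k\<^esub> n)) - real n * r\<bar> \<le> length v + 1"
      using aw occ_power[of w v n] by (auto simp: r_def cyclic_powers(2))
    moreover have "\<bar>real (occ v (g [^]\<^bsub>free_group k\<^esub> n)) - occ v (w [^]\<^bsub>free_group k\<^esub> n)\<bar> \<le> 2 * length a"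
      unfolding g using aw by (intro occ_conj_pow) (auto simp: cyclically_reduced_words_def)
    ultimately show ?thesis by simp
  qed
  then show ?thesis
    by (intro exI[of _ "real r"] exI[of _ "real (2 * length a + length v + 1)"]) auto
qed

lemma asym_occ_bounded_error:
  assumes "g \<in> reduced_words k"
  obtains C where "\<And>n. \<bar>real (occ v (g [^]\<^bsub>free_group k\<^esub> n)) - real n * asym_occ k v g\<bar> \<le> C"
  using asym_occ_exists[OF assms, of v] asym_occ_eqI by metis

lemma asym_occ_nonneg: "g \<in> reduced_words k \<Longrightarrow> 0 \<le> asym_occ k v g"
  using asym_occ_exists[of g k v] asym_occ_eqI by metis

lemma asym_occ_tendsto:
  assumes "g \<in> reduced_words k"
  shows "(\<lambda>n. real (occ v (g [^]\<^bsub>free_group k\<^esub> n)) / real n) \<longlonglongrightarrow> asym_occ k v g"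
  by (rule asym_occ_bounded_error[OF assms]) (rule tendsto_div_of_bounded_error)

lemma asym_occ_cyclically_reduced:
  assumes "w \<in> cyclically_reduced_words k" "w \<noteq> []"
  shows "asym_occ k v w = occurrences w v"
  using occ_power[OF assms(2)] by (intro asym_occ_eqI) (simp add: cyclic_powers(2)[OF assms(1)])

lemma asym_occ_conj:
  assumes "a \<in> reduced_words k" "g \<in> reduced_words k"
  shows "asym_occ k v (a \<otimes>\<^bsub>free_group k\<^esub> g \<otimes>\<^bsub>free_group k\<^esub> inv\<^bsub>free_group k\<^esub> a) = asym_occ k v g"
proof -
  obtain C where C: "\<And>n. \<bar>real (occ v (g [^]\<^bsub>free_group k\<^esub> n)) - real n * asym_occ k v g\<bar> \<le> C"
    using asym_occ_bounded_error[OF assms(2)] by blast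
  show ?thesis
  proof (rule asym_occ_eqI)
    fix n
    show "\<bar>real (occ v ((a \<otimes>\<^bsub>free_group k\<^esub> g \<otimes>\<^bsub>free_group k\<^esub> inv\<^bsub>free_group k\<^esub> a) [^]\<^bsub>free_group k\<^esub> n)) -
        real n * asym_occ k v g\<bar> \<le> C + 2 * length a"
      using C[of n] occ_conj_pow[OF assms, of v n] by linarith
  qed
qed

lemma occurrences_Nil [simp]: "occurrences w [] = length w"
  by (simp add: occurrences_def)

text \<open>The rate of the empty word is the length of the cyclic reduction, which is empty only
  for the trivial element. It is the denominator of all frequencies.\<close>

lemma asym_occ_Nil_pos:
  assumes "g \<in> reduced_words k" "g \<noteq> []"
  shows "0 < asym_occ k [] g"
proof -
  interpret F: group "free_group k" by (rule group_free_group)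
  obtain a w where aw: "a \<in> reduced_words k" "w \<in> cyclically_reduced_words k"
    and g: "g = a \<otimes>\<^bsub>free_group k\<^esub> w \<otimes>\<^bsub>free_group k\<^esub> inv\<^bsub>free_group k\<^esub> a"
    using conj_cyclically_reduced[OF assms(1)] by blast
  have "w \<noteq> []"
    using assms(2) g aw by (auto simp flip: one_free_group[of k])
  then show ?thesis
    unfolding g using aw
    by (subst asym_occ_conj) (auto simp: asym_occ_cyclically_reduced cyclically_reduced_words_def)
qed

section \<open>Balance between left and right extensions of a factor\<close>

lemma occ_pos_factor:
  assumes "occ v g > 0"
  obtains p s where "g = p @ v @ s"
proof -
  have "\<exists>p s. g = p @ v @ s"
    using assms
  proof (induction g)
    case (Cons x g)
    show ?case
    proof (cases "prefix v (x # g)")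
      case True
      then show ?thesis
        by (metis append_Nil prefix_def)
    next
      case False
      with Cons obtain p s where "g = p @ v @ s" by auto
      then have "x # g = (x # p) @ v @ s" by simp
      then show ?thesis by blast
    qed
  qed (auto split: if_splits)
  then show ?thesis using that by blast
qed

lemma occ_not_reduced:
  assumes "g \<in> reduced_words k" "v \<notin> reduced_words k"
  shows "occ v g = 0"
proof (rule ccontr)
  assume "occ v g \<noteq> 0"
  then obtain p s where "g = p @ v @ s"
    using occ_pos_factor[of v g] by auto
  with assms show False
    by (auto simp: reduced_words_append)
qed

lemma finite_letters [simp]: "finite (letters k)"
  by (simp add: letters_def)

lemma finite_words [simp]: "finite (words k m)"
  by (rule finite_subset[OF _ finite_lists_length_eq[OF finite_letters, of k m]])
     (auto simp: words_def reduced_words_def)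

lemma finite_extensions [simp]: "finite {x. x \<in> letters k \<and> P x}"
  by (rule finite_subset[OF _ finite_letters[of k]]) auto

lemma words_snoc_iff:
  "u \<in> words k m \<Longrightarrow> u @ [x] \<in> words k (Suc m) \<longleftrightarrow> u @ [x] \<in> reduced_words k"
  and words_Cons_iff:
  "u \<in> words k m \<Longrightarrow> x # u \<in> words k (Suc m) \<longleftrightarrow> x # u \<in> reduced_words k"
  by (simp_all add: words_def)

text \<open>Every occurrence of \<open>u\<close> is followed by exactly one letter, except one at
  the end of \<open>g\<close>. Extensions that are not reduced never occur in \<open>g\<close>, so
  the sum may be taken over all letters.\<close>

lemma occ_sum_snoc:
  assumes "g \<in> reduced_words k"
  shows "(\<Sum>x | x \<in> letters k \<and> u @ [x] \<in> reduced_words k. occ (u @ [x]) g) + of_bool (suffix u g) = occ u g"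
proof -
  have "(\<Sum>x | x \<in> letters k \<and> u @ [x] \<in> reduced_words k. occ (u @ [x]) g) = (\<Sum>x\<in>letters k. occ (u @ [x]) g)"
    using occ_not_reduced[OF assms] by (intro sum.mono_neutral_left) auto
  moreover have "(\<Sum>x\<in>letters k. occ (u @ [x]) g) + of_bool (suffix u g) = occ u g"
    if "g \<in> lists (letters k)"
    using that
  proof (induction g rule: rev_induct)
    case (snoc z g)
    have "(\<Sum>x\<in>letters k. of_bool (suffix (u @ [x]) (g @ [z])) :: nat) = of_bool (suffix u g)"
    proof -
      have "(\<Sum>x\<in>letters k. of_bool (suffix (u @ [x]) (g @ [z])) :: nat) =
          (\<Sum>x\<in>letters k. if z = x then of_bool (suffix u g) else 0)"
        by (intro sum.cong) auto
      then show ?thesis using snoc.prems by simp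
    qed
    with snoc show ?case
      by (simp add: occ_snoc sum.distrib)
  qed simp
  ultimately show ?thesis
    using assms by (simp add: reduced_words_def)
qed

lemma occ_sum_Cons:
  assumes "g \<in> reduced_words k"
  shows "(\<Sum>y | y \<in> letters k \<and> y # u \<in> reduced_words k. occ (y # u) g) + of_bool (prefix u g) = occ u g"
proof -
  have "(\<Sum>y | y \<in> letters k \<and> y # u \<in> reduced_words k. occ (y # u) g) = (\<Sum>y\<in>letters k. occ (y # u) g)"
    using occ_not_reduced[OF assms] by (intro sum.mono_neutral_left) auto
  moreover have "(\<Sum>y\<in>letters k. occ (y # u) g) + of_bool (prefix u g) = occ u g"
    if "g \<in> lists (letters k)"
    using that
  proof (induction g rule: list.induct)
    case (Cons z g)
    have "(\<Sum>x\<in>letters k. of_bool (prefix (x # u) (z # g)) :: nat) = of_bool (prefix u g)"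
    proof -
      have "(\<Sum>x\<in>letters k. of_bool (prefix (x # u) (z # g)) :: nat) =
          (\<Sum>x\<in>letters k. if z = x then of_bool (prefix u g) else 0)"
        by (intro sum.cong) auto
      then show ?thesis using Cons.prems by simp
    qed
    with Cons show ?case
      by (simp add: sum.distrib)
  qed (simp add: prefix_def)
  ultimately show ?thesis
    using assms by (simp add: reduced_words_def)
qed

text \<open>\<open>of_bool (P n)\<close> stands for the single occurrence at an end of the word.
  Divided by \<open>n\<close> it vanishes, so the count becomes an exact identity between rates;
  right and left extensions are two instances and give the balance equations of
  \<open>Qset\<close>.\<close>

lemma asym_occ_sum_of_bool:
  assumes "g \<in> reduced_words k"
    and "\<And>n. sum (\<lambda>x. occ (e x) (g [^]\<^bsub>free_group k\<^esub> n)) A + of_bool (P n) = occ u (g [^]\<^bsub>free_group k\<^esub> (n::nat))"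
  shows "(\<Sum>x\<in>A. asym_occ k (e x) g) = asym_occ k u g"
proof -
  have "(\<lambda>n. \<Sum>x\<in>A. real (occ (e x) (g [^]\<^bsub>free_group k\<^esub> n)) / real n) \<longlonglongrightarrow> (\<Sum>x\<in>A. asym_occ k (e x) g)"
    by (intro tendsto_sum asym_occ_tendsto assms)
  moreover have "(\<lambda>n. of_bool (P n) / real n) \<longlonglongrightarrow> 0"
    by (rule tendsto_div_of_bounded_error[where C = 1]) simp
  ultimately have "(\<lambda>n. (\<Sum>x\<in>A. real (occ (e x) (g [^]\<^bsub>free_group k\<^esub> n)) / real n) + of_bool (P n) / real n)
      \<longlonglongrightarrow> (\<Sum>x\<in>A. asym_occ k (e x) g) + 0"
    by (rule tendsto_add)
  moreover have eq: "(\<Sum>x\<in>A. real (occ (e x) (g [^]\<^bsub>free_group k\<^esub> n)) / real n) + of_bool (P n) / real n =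
      real (occ u (g [^]\<^bsub>free_group k\<^esub> n)) / real n" for n
    using assms(2)[of n, symmetric] by (simp add: add_divide_distrib sum_divide_distrib)
  ultimately have "(\<lambda>n. real (occ u (g [^]\<^bsub>free_group k\<^esub> n)) / real n) \<longlonglongrightarrow> (\<Sum>x\<in>A. asym_occ k (e x) g)"
    by (simp only: add_0_right)
  from LIMSEQ_unique[OF this asym_occ_tendsto[OF assms(1)]] show ?thesis .
qed

lemma asym_occ_sum_snoc:
  assumes "g \<in> reduced_words k" "u \<in> words k m"
  shows "(\<Sum>x | x \<in> letters k \<and> u @ [x] \<in> words k (Suc m). asym_occ k (u @ [x]) g) = asym_occ k u g"
  unfolding words_snoc_iff[OF assms(2)]
  by (rule asym_occ_sum_of_bool[where e = "\<lambda>x. u @ [x]" and P = "\<lambda>n. suffix u (g [^]\<^bsub>free_group k\<^esub> n)"])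
     (rule assms(1), rule occ_sum_snoc, rule free_group_closed(3), rule assms(1))

lemma asym_occ_sum_Cons:
  assumes "g \<in> reduced_words k" "u \<in> words k m"
  shows "(\<Sum>x | x \<in> letters k \<and> x # u \<in> words k (Suc m). asym_occ k (x # u) g) = asym_occ k u g"
  unfolding words_Cons_iff[OF assms(2)]
  by (rule asym_occ_sum_of_bool[where e = "\<lambda>x. x # u" and P = "\<lambda>n. prefix u (g [^]\<^bsub>free_group k\<^esub> n)"])
     (rule assms(1), rule occ_sum_Cons, rule free_group_closed(3), rule assms(1))

lemma sum_words_Suc:
  "(\<Sum>v\<in>words k (Suc m). f v) =
    (\<Sum>u\<in>words k m. \<Sum>x | x \<in> letters k \<and> u @ [x] \<in> words k (Suc m). f (u @ [x]))"
proof -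
  have "(\<Sum>v\<in>words k (Suc m). f v) =
      (\<Sum>p\<in>(SIGMA u:words k m. {x. x \<in> letters k \<and> u @ [x] \<in> words k (Suc m)}). f (fst p @ [snd p]))"
  proof (rule sum.reindex_bij_betw[symmetric])
    show "bij_betw (\<lambda>p. fst p @ [snd p])
        (SIGMA u:words k m. {x. x \<in> letters k \<and> u @ [x] \<in> words k (Suc m)}) (words k (Suc m))"
    proof (rule bij_betwI')
      fix v assume v: "v \<in> words k (Suc m)"
      then obtain u x where "v = u @ [x]"
        by (cases v rule: rev_cases) (auto simp: words_def)
      with v show "\<exists>p\<in>(SIGMA u:words k m. {x. x \<in> letters k \<and> u @ [x] \<in> words k (Suc m)}).
          v = fst p @ [snd p]"
        by (intro bexI[of _ "(u, x)"]) (auto simp: words_def reduced_words_def freely_reduced_append)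
    qed auto
  qed
  then show ?thesis
    by (simp add: sum.Sigma case_prod_unfold)
qed

lemma asym_occ_sum_words:
  assumes "g \<in> reduced_words k"
  shows "(\<Sum>v\<in>words k m. asym_occ k v g) = asym_occ k [] g"
proof (induction m)
  case 0
  have "words k 0 = {[]}"
    by (auto simp: words_def)
  then show ?case by simp
next
  case (Suc m)
  then show ?case
    by (simp add: sum_words_Suc asym_occ_sum_snoc[OF assms])
qed

section \<open>Bounded cancellation\<close>

lemma length_reduce_le: "length (reduce w) \<le> length w"
proof (induction w)
  case (Cons x w)
  have "length (cons_reduce x u) \<le> Suc (length u)" for u
    by (auto simp: cons_reduce_def)
  from this[of "reduce w"] Cons show ?case
    by (simp add: reduce_def)
qed (simp add: reduce_def)

lemma length_mult_le: "length (u \<otimes>\<^bsub>free_group k\<^esub> v) \<le> length u + length v"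
  using length_reduce_le[of "u @ v"] by (simp add: mult_free_group)

lemma length_inv: "u \<in> reduced_words k \<Longrightarrow> length (inv\<^bsub>free_group k\<^esub> u) = length u"
  by (simp add: inv_free_group)

lemma reduce_word_inv_cancel: "freely_reduced s \<Longrightarrow> reduce (word_inv p @ p @ s) = s"
  using foldr_cons_reduce_word_inv[of s p] reduce_ident[of s] by (simp add: reduce_def)

lemma reduce_cancel_word_inv:
  "freely_reduced s \<Longrightarrow> reduce (p @ d @ word_inv d @ s) = reduce (p @ s)"
  using foldr_cons_reduce_word_inv[of s "word_inv d"] reduce_ident[of s] by (simp add: reduce_def)

text \<open>The left inverse is carried along because its Lipschitz constant is what prevents \<phi>
  from shrinking lengths by more than a constant factor. Together with the Lipschitz bound for
  \<phi> this makes \<phi> a quasi-isometric embedding.\<close>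

locale free_group_retract =
  fixes k :: nat and \<phi> \<psi> :: "word \<Rightarrow> word"
  assumes hom_\<phi>: "\<phi> \<in> hom (free_group k) (free_group k)"
    and hom_\<psi>: "\<psi> \<in> hom (free_group k) (free_group k)"
    and \<psi>_\<phi>: "g \<in> reduced_words k \<Longrightarrow> \<psi> (\<phi> g) = g"
begin

sublocale F: group "free_group k"
  by (rule group_free_group)

sublocale \<phi>: group_hom "free_group k" "free_group k" \<phi>
  using hom_\<phi> by unfold_locales

lemma \<phi>_closed [simp]: "g \<in> reduced_words k \<Longrightarrow> \<phi> g \<in> reduced_words k"
  using \<phi>.hom_closed[of g] by simp

lemma \<phi>_append:
  assumes "a @ b \<in> reduced_words k"
  shows "\<phi> (a @ b) = reduce (\<phi> a @ \<phi> b)"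
proof -
  have "a @ b = a \<otimes>\<^bsub>free_group k\<^esub> b"
    using assms by (simp add: mult_free_group reduce_ident reduced_wordsD)
  then show ?thesis
    using assms \<phi>.hom_mult[of a b] by (simp add: reduced_words_append mult_free_group)
qed

lemma \<phi>_word_inv: "g \<in> reduced_words k \<Longrightarrow> \<phi> (word_inv g) = word_inv (\<phi> g)"
  using \<phi>.hom_inv[of g] by (simp add: inv_free_group)

lemma \<phi>_Nil [simp]: "\<phi> [] = []"
  using \<phi>.hom_one by (simp add: one_free_group)

end

text \<open>Each letter contributes at most the length of its image. \<open>L\<close> adds up all
  letter images, and the successor ensures \<open>L \<ge> 1\<close>.\<close>

lemma hom_lipschitz:
  assumes "\<phi> \<in> hom (free_group k) (free_group k)"
  obtains L where "L \<ge> 1" "\<And>g. g \<in> reduced_words k \<Longrightarrow> length (\<phi> g) \<le> L * length g"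
proof -
  interpret \<phi>: group_hom "free_group k" "free_group k" \<phi>
    using assms group_free_group by (simp add: group_hom_def group_hom_axioms_def)
  define L where "L = Suc (\<Sum>x\<in>letters k. length (\<phi> [x]))"
  have L: "length (\<phi> [x]) \<le> L" if "x \<in> letters k" for x
    using member_le_sum[OF that, of "\<lambda>x. length (\<phi> [x])"] by (simp add: L_def)
  have "length (\<phi> g) \<le> L * length g" if "g \<in> reduced_words k" for g
    using that
  proof (induction g rule: list.induct)
    case Nil
    then show ?case
      using \<phi>.hom_one by (simp add: one_free_group)
  next
    case (Cons x g)
    then have red: "x \<in> letters k" "[x] \<in> reduced_words k" "g \<in> reduced_words k"
      by (auto simp: reduced_words_Cons)
    have "x # g = [x] \<otimes>\<^bsub>free_group k\<^esub> g"
      using Cons.prems by (simp add: mult_free_group reduce_ident reduced_wordsD)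
    then have "\<phi> (x # g) = \<phi> [x] \<otimes>\<^bsub>free_group k\<^esub> \<phi> g"
      using red \<phi>.hom_mult[of "[x]" g] by simp
    then have "length (\<phi> (x # g)) \<le> length (\<phi> [x]) + length (\<phi> g)"
      by (simp add: length_mult_le)
    with Cons.IH L red show ?case
      by fastforce
  qed
  with that[of L] show ?thesis
    by (simp add: L_def)
qed

context free_group_retract
begin

text \<open>Reading \<open>b\<close> letter by letter gives a walk in the Cayley tree from the
  identity to \<phi>\<open>b\<close> with steps of length at most \<open>L\<close>, and such a walk
  cannot bypass the vertex \<open>p\<close>. The prefix chosen is where the walk last enters the
  branch of words beginning with \<open>p\<close>; what sticks out beyond \<open>p\<close> is then a
  suffix of the image of one letter.\<close>

lemma prefix_near_image:
  assumes L: "\<And>g. g \<in> reduced_words k \<Longrightarrow> length (\<phi> g) \<le> L * length g"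
    and "b \<in> reduced_words k" "prefix p (\<phi> b)"
  shows "\<exists>b'. prefix b' b \<and> length (reduce (word_inv p @ \<phi> b')) \<le> L"
  using assms(2,3)
proof (induction b rule: rev_induct)
  case Nil
  then show ?case by (simp add: reduce_def)
next
  case (snoc x b)
  then have red: "b \<in> reduced_words k" "[x] \<in> reduced_words k"
    by (auto simp: reduced_words_append)
  show ?case
  proof (cases "prefix p (\<phi> b)")
    case True
    with snoc.IH red show ?thesis
      by (meson prefix_order.trans prefixI)
  next
    case False
    obtain e f h where efh: "\<phi> b = e @ f" "\<phi> [x] = word_inv f @ h"
        "reduce (\<phi> b @ \<phi> [x]) = e @ h" "freely_reduced (e @ h)"
      using cancellation[of "\<phi> b" "\<phi> [x]"] red by (metis \<phi>_closed reduced_wordsD)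
    have im: "\<phi> (b @ [x]) = e @ h"
      using \<phi>_append[OF snoc.prems(1)] efh by simp
    then obtain h' h'' where h: "p = e @ h'" "h = h' @ h''"
      using snoc.prems(2) False efh(1) by (metis prefix_append prefixE prefixI)
    have "reduce (word_inv p @ \<phi> (b @ [x])) = h''"
      using reduce_word_inv_cancel[of h'' p] efh(4) im h by (simp add: freely_reduced_append)
    moreover have "length h'' \<le> length (\<phi> [x])"
      using efh(2) h by simp
    ultimately have "length (reduce (word_inv p @ \<phi> (b @ [x]))) \<le> L"
      using L[OF red(2)] by simp
    then show ?thesis by blast
  qed
qed

text \<open>If a long word \<open>c\<close> cancels between \<open>\<phi> a\<close> and \<open>\<phi> b\<close>, then the \<open>\<phi>\<close>-images of the geodesics
  from the junction of \<open>a\<close> and \<open>b\<close> to the two ends both come near the far end of \<open>c\<close>; as \<open>\<psi>\<close> is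
  Lipschitz, this happens at points near each other, hence near the junction.\<close>

lemma bounded_cancellation:
  obtains B where "\<And>a b p c s. a @ b \<in> reduced_words k \<Longrightarrow> \<phi> a = p @ c \<Longrightarrow> \<phi> b = word_inv c @ s \<Longrightarrow>
    length c \<le> B"
proof -
  obtain L where L: "\<And>g. g \<in> reduced_words k \<Longrightarrow> length (\<phi> g) \<le> L * length g"
    using hom_lipschitz[OF hom_\<phi>] by blast
  obtain M where M: "\<And>g. g \<in> reduced_words k \<Longrightarrow> length (\<psi> g) \<le> M * length g"
    using hom_lipschitz[OF hom_\<psi>] by blast
  \<comment> \<open>The first \<open>L\<close> bounds the distance from the far end of
    \<open>c\<close> to the image of \<open>b'\<close>; the product bounds the length of that image,
    via \<open>length b' \<le> M * (2 * L)\<close>.\<close>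
  have "length c \<le> L + L * (M * (2 * L))"
    if ab: "a @ b \<in> reduced_words k" and a: "\<phi> a = p @ c" and b: "\<phi> b = word_inv c @ s" for a b p c s
  proof -
    have red: "a \<in> reduced_words k" "b \<in> reduced_words k"
      using ab by (auto simp: reduced_words_append)
    have c: "c \<in> reduced_words k"
      using a \<phi>_closed[OF red(1)] by (simp add: reduced_words_append)
    obtain b' where b': "prefix b' b" "length (reduce (c @ \<phi> b')) \<le> L"
      using prefix_near_image[OF L red(2), of "word_inv c"] b by auto
    have "prefix (word_inv c) (\<phi> (word_inv a))"
      using a red by (simp add: \<phi>_word_inv)
    then obtain a' where a': "prefix a' (word_inv a)" "length (reduce (c @ \<phi> a')) \<le> L"
      using prefix_near_image[OF L word_inv_in_reduced_words[OF red(1)], of "word_inv c"] by auto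
    obtain a'' b'' where "word_inv a = a' @ a''" and b'': "b = b' @ b''"
      using a'(1) b'(1) by (auto simp: prefix_def)
    then have a'': "a = word_inv a'' @ word_inv a'"
      by (metis word_inv_word_inv word_inv_simps(3))
    \<comment> \<open>As a factor of \<open>a @ b\<close> this word is reduced, so a bound on its
      length as a group element is also a bound on \<open>length b'\<close>.\<close>
    have red': "word_inv a' @ b' \<in> reduced_words k"
    proof -
      have "word_inv a'' @ (word_inv a' @ b') @ b'' \<in> reduced_words k"
        using ab by (simp add: a'' b'')
      then show ?thesis by (simp only: reduced_words_append)
    qed
    then have r: "a' \<in> reduced_words k" "b' \<in> reduced_words k"
      using word_inv_in_reduced_words[of "word_inv a'" k] by (auto simp: reduced_words_append)
    \<comment> \<open>\<open>word_inv c\<close> is the far end of the cancelled word;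
      \<open>?u\<close> and \<open>?w\<close> are the displacements from it to the images of
      \<open>a'\<close> and \<open>b'\<close>, both of length at most \<open>L\<close>.\<close>
    let ?u = "c \<otimes>\<^bsub>free_group k\<^esub> \<phi> a'" and ?w = "c \<otimes>\<^bsub>free_group k\<^esub> \<phi> b'"
    have "word_inv a' @ b' = inv\<^bsub>free_group k\<^esub> a' \<otimes>\<^bsub>free_group k\<^esub> b'"
      using red' r by (simp add: mult_free_group inv_free_group reduce_ident reduced_wordsD)
    then have "\<phi> (word_inv a' @ b') = inv\<^bsub>free_group k\<^esub> (\<phi> a') \<otimes>\<^bsub>free_group k\<^esub> \<phi> b'"
      using r \<phi>.hom_mult[of "inv\<^bsub>free_group k\<^esub> a'" b'] by (simp add: \<phi>.hom_inv)
    also have "\<dots> = inv\<^bsub>free_group k\<^esub> ?u \<otimes>\<^bsub>free_group k\<^esub> ?w"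
      using r c by (simp add: F.inv_mult_group F.m_assoc)
    finally have "length (\<phi> (word_inv a' @ b')) \<le> length ?u + length ?w"
      using length_mult_le[of k "inv\<^bsub>free_group k\<^esub> ?u" ?w] r c by (simp add: length_inv)
    then have "length (\<phi> (word_inv a' @ b')) \<le> 2 * L"
      using a' b' by (simp add: mult_free_group)
    then have "length (word_inv a' @ b') \<le> M * (2 * L)"
      using M[OF \<phi>_closed[OF red']] \<psi>_\<phi>[OF red'] by (metis le_trans mult_le_mono2)
    then have "length b' \<le> M * (2 * L)" by simp
    then have 1: "length (\<phi> b') \<le> L * (M * (2 * L))"
      using L[OF r(2)] by (meson le_trans mult_le_mono2)
    have "c = ?w \<otimes>\<^bsub>free_group k\<^esub> inv\<^bsub>free_group k\<^esub> (\<phi> b')"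
      using r c by (simp add: F.m_assoc)
    then have "length c \<le> length ?w + length (\<phi> b')"
      using length_mult_le[of k ?w "inv\<^bsub>free_group k\<^esub> (\<phi> b')"] r by (simp add: length_inv)
    then show ?thesis
      using 1 b' by (simp add: mult_free_group)
  qed
  then show ?thesis using that by blast
qed

text \<open>The image of a long \<open>b\<close> has a middle part \<open>q\<close>, longer than
  \<open>v\<close>, that survives cancellation on both sides. All four images contain
  \<open>q\<close>; its left context depends only on whether \<open>x\<close> is present and its
  right context only on whether \<open>a\<close> is, so by \<open>occ_append_overlap\<close> the
  contributions cancel.\<close>

lemma occ_image_local:
  obtains K where "\<And>x b a. x # b @ a \<in> reduced_words k \<Longrightarrow> K \<le> length b \<Longrightarrow>
    occ v (\<phi> (x # b @ a)) + occ v (\<phi> b) = occ v (\<phi> (x # b)) + occ v (\<phi> (b @ a))"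
proof -
  obtain L where L: "\<And>g. g \<in> reduced_words k \<Longrightarrow> length (\<phi> g) \<le> L * length g"
    using hom_lipschitz[OF hom_\<phi>] by blast
  obtain M where M: "\<And>g. g \<in> reduced_words k \<Longrightarrow> length (\<psi> g) \<le> M * length g"
    using hom_lipschitz[OF hom_\<psi>] by blast
  obtain B where B: "\<And>a b p c s. a @ b \<in> reduced_words k \<Longrightarrow> \<phi> a = p @ c \<Longrightarrow> \<phi> b = word_inv c @ s \<Longrightarrow>
      length c \<le> B"
    using bounded_cancellation by blast
  \<comment> \<open>At most \<open>L\<close> letters are lost to the image of \<open>x\<close> and
    at most \<open>B\<close> to that of \<open>a\<close>. As \<psi> stretches lengths by at most
    \<open>M\<close>, a \<open>b\<close> of length \<open>K\<close> has an image longer than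
    \<open>L + B + length v\<close>.\<close>
  define K where "K = Suc (M * (L + B + length v))"
  have "occ v (\<phi> (x # b @ a)) + occ v (\<phi> b) = occ v (\<phi> (x # b)) + occ v (\<phi> (b @ a))"
    if xba: "x # b @ a \<in> reduced_words k" and len: "K \<le> length b" for x b a
  proof -
    have xb: "[x] @ b \<in> reduced_words k" and ba: "b @ a \<in> reduced_words k"
      and xba': "[x] @ (b @ a) \<in> reduced_words k"
      using xba reduced_words_append[of "x # b" a k] reduced_words_append[of "[x]" "b @ a" k] by auto
    then have red: "[x] \<in> reduced_words k" "b \<in> reduced_words k" "a \<in> reduced_words k"
      by (auto simp only: reduced_words_append)
    obtain X d Y where 1: "\<phi> [x] = X @ d" "\<phi> b = word_inv d @ Y" "reduce (\<phi> [x] @ \<phi> b) = X @ Y"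
        "freely_reduced (X @ Y)"
      using cancellation[of "\<phi> [x]" "\<phi> b"] red by (metis \<phi>_closed reduced_wordsD)
    obtain P c A where 2: "\<phi> b = P @ c" "\<phi> a = word_inv c @ A" "reduce (\<phi> b @ \<phi> a) = P @ A"
        "freely_reduced (P @ A)"
      using cancellation[of "\<phi> b" "\<phi> a"] red by (metis \<phi>_closed reduced_wordsD)
    have "length c \<le> B"
      using B[OF ba 2(1,2)] .
    moreover have "length d \<le> L"
      using L[OF red(1)] 1(1) by simp
    moreover have "L + B + length v < length (\<phi> b)"
    proof (rule ccontr)
      assume "\<not> ?thesis"
      then have "M * length (\<phi> b) \<le> M * (L + B + length v)"
        by (intro mult_le_mono2) simp
      with M[OF \<phi>_closed[OF red(2)]] len show False
        by (simp add: \<psi>_\<phi> red K_def)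
    qed
    moreover have "length (\<phi> b) = length P + length c" "length (\<phi> b) = length d + length Y"
      using arg_cong[OF 2(1), of length] arg_cong[OF 1(2), of length] by simp_all
    ultimately have len: "length v + length d < length P" "length v < length Y"
      by linarith+
    have "word_inv d @ Y = P @ c"
      using 1(2) 2(1) by simp
    with len obtain q where q: "P = word_inv d @ q" "Y = q @ c"
      by (auto simp: append_eq_append_conv2 dest: arg_cong[where f = length])
    with len have lq: "length v < length q" by simp
    then have "q \<noteq> []" by auto
    have fr: "freely_reduced (X @ q @ A)"
      using 1(4) 2(4) \<open>q \<noteq> []\<close> by (simp add: q freely_reduced_append)
    have "\<phi> ([x] @ (b @ a)) = reduce (\<phi> [x] @ \<phi> (b @ a))"
      by (rule \<phi>_append[OF xba'])
    also have "\<phi> (b @ a) = word_inv d @ q @ A"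
      using \<phi>_append[OF ba] 2(3) q by simp
    also have "reduce (\<phi> [x] @ word_inv d @ q @ A) = X @ q @ A"
      using reduce_cancel_word_inv[of "q @ A" X d] fr 1(1) by (simp add: freely_reduced_append reduce_ident)
    finally have i1: "\<phi> (x # b @ a) = X @ q @ A" by simp
    have i2: "\<phi> (x # b) = X @ q @ c"
      using \<phi>_append[OF xb] 1(3) q by simp
    have i3: "\<phi> (b @ a) = word_inv d @ q @ A"
      using \<phi>_append[OF ba] 2(3) q by simp
    have i4: "\<phi> b = word_inv d @ q @ c"
      using 1(2) q by simp
    show ?thesis
      unfolding i1 i2 i3 i4
      using occ_append_overlap[of v q X A] occ_append_overlap[of v q X c]
        occ_append_overlap[of v q "word_inv d" A] occ_append_overlap[of v q "word_inv d" c] lq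
      by simp
  qed
  then show ?thesis using that by blast
qed

end

section \<open>Functions whose increments depend on a window of bounded length\<close>

lemma occ_zero_short: "length g < length u \<Longrightarrow> occ u g = 0"
  using occ_pos_factor[of u g] by fastforce

text \<open>Removing the first letter of a long \<open>g\<close> changes \<open>f\<close> by
  \<open>f u - f (tl u)\<close>, where \<open>u\<close> is formed by the first \<open>K + 1\<close>
  letters. Telescoping over the suffixes of \<open>g\<close> meets each \<open>u\<close> exactly
  \<open>occ u g\<close> times and ends at a word of length at most \<open>K\<close>; there are
  finitely many of these, which bounds the remainder.\<close>

lemma local_function_decomposition:
  fixes f :: "word \<Rightarrow> real"
  assumes local: "\<And>x b a. x # b @ a \<in> reduced_words k \<Longrightarrow> K \<le> length b \<Longrightarrow>
    f (x # b @ a) + f b = f (x # b) + f (b @ a)"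
  shows "\<exists>C. \<forall>g\<in>reduced_words k. \<bar>f g - (\<Sum>u\<in>words k (Suc K). (f u - f (tl u)) * occ u g)\<bar> \<le> C"
proof -
  define W where "W = (\<Union>m\<le>K. words k m)"
  have "\<bar>f g - (\<Sum>u\<in>words k (Suc K). (f u - f (tl u)) * occ u g)\<bar> \<le> (\<Sum>u\<in>W. \<bar>f u\<bar>)"
    if "g \<in> reduced_words k" for g
    using that
  proof (induction "length g" arbitrary: g rule: less_induct)
    case less
    show ?case
    proof (cases "length g \<le> K")
      case True
      then have "g \<in> W"
        using less.prems by (auto simp: W_def words_def)
      then have "\<bar>f g\<bar> \<le> (\<Sum>u\<in>W. \<bar>f u\<bar>)"
        by (intro member_le_sum) (auto simp: W_def)
      moreover have "(\<Sum>u\<in>words k (Suc K). (f u - f (tl u)) * occ u g) = 0"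
        using True by (intro sum.neutral) (auto simp: words_def occ_zero_short)
      ultimately show ?thesis by simp
    next
      case False
      then obtain x g' where g: "g = x # g'" and K: "K \<le> length g'"
        by (cases g) auto
      define b a where "b = take K g'" and "a = drop K g'"
      have g': "g' = b @ a" and b: "length b = K"
        using K by (auto simp: a_def b_def)
      have red: "x # b \<in> words k (Suc K)" "g' \<in> reduced_words k"
        using less.prems reduced_words_append[of "x # b" a k] reduced_words_append[of "[x]" g' k] b
        by (auto simp: words_def g g')
      \<comment> \<open>Among the words of length \<open>K + 1\<close> only \<open>x # b\<close> is
        a prefix of \<open>g\<close>, so passing from \<open>g'\<close> to \<open>g\<close> changes
        a single count.\<close>
      have "(\<Sum>u\<in>words k (Suc K). (f u - f (tl u)) * of_bool (prefix u g)) =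
          (\<Sum>u\<in>words k (Suc K). if x # b = u then f (x # b) - f b else 0)"
      proof (intro sum.cong refl)
        fix u assume "u \<in> words k (Suc K)"
        then have "length u = length (x # b)"
          by (simp add: words_def b)
        then have "prefix u g \<longleftrightarrow> x # b = u"
          by (auto simp: g g' prefix_def) (metis append_Cons append_eq_append_conv length_Cons)
        then show "(f u - f (tl u)) * of_bool (prefix u g) = (if x # b = u then f (x # b) - f b else 0)"
          by auto
      qed
      then have "(\<Sum>u\<in>words k (Suc K). (f u - f (tl u)) * occ u g) =
          (\<Sum>u\<in>words k (Suc K). (f u - f (tl u)) * occ u g') + (f (x # b) - f b)"
        using red by (simp add: g sum.distrib distrib_left)
      moreover have "f g = f g' + (f (x # b) - f b)"
        using local[of x b a] less.prems b by (simp add: g g')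
      ultimately show ?thesis
        using less.hyps[of g'] red by (simp add: g)
    qed
  qed
  then show ?thesis by blast
qed

context free_group_retract
begin

lemma \<phi>_pow:
  assumes "g \<in> reduced_words k"
  shows "\<phi> (g [^]\<^bsub>free_group k\<^esub> (n::nat)) = \<phi> g [^]\<^bsub>free_group k\<^esub> n"
  using \<phi>.hom_nat_pow[of g n] assms by simp

text \<open>Decompose the count of \<open>v\<close> in \<phi>\<open>g\<close> and evaluate along
  powers of \<open>g\<close>, which \<phi> maps to powers; the bounded error disappears. The weights
  \<open>f u - f (tl u)\<close> may be negative, so nonnegativity of the extended map cannot be read
  off the formula.\<close>

lemma asym_occ_image:
  obtains K \<delta> where "\<And>g. g \<in> reduced_words k \<Longrightarrow>
    asym_occ k v (\<phi> g) = (\<Sum>u\<in>words k K. \<delta> u * asym_occ k u g)"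
proof -
  obtain K where K: "\<And>x b a. x # b @ a \<in> reduced_words k \<Longrightarrow> K \<le> length b \<Longrightarrow>
    occ v (\<phi> (x # b @ a)) + occ v (\<phi> b) = occ v (\<phi> (x # b)) + occ v (\<phi> (b @ a))"
    using occ_image_local by blast
  define f where "f g = real (occ v (\<phi> g))" for g
  have "\<exists>C. \<forall>g\<in>reduced_words k. \<bar>f g - (\<Sum>u\<in>words k (Suc K). (f u - f (tl u)) * occ u g)\<bar> \<le> C"
    using K unfolding f_def by (intro local_function_decomposition) (metis of_nat_add)
  then obtain C where
    C: "\<And>g. g \<in> reduced_words k \<Longrightarrow> \<bar>f g - (\<Sum>u\<in>words k (Suc K). (f u - f (tl u)) * occ u g)\<bar> \<le> C"
    by blast
  have "asym_occ k v (\<phi> g) = (\<Sum>u\<in>words k (Suc K). (f u - f (tl u)) * asym_occ k u g)"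
    if g: "g \<in> reduced_words k" for g
  proof -
    let ?p = "\<lambda>n::nat. g [^]\<^bsub>free_group k\<^esub> n"
    have "(\<lambda>n. (f (?p n) - (\<Sum>u\<in>words k (Suc K). (f u - f (tl u)) * occ u (?p n))) / real n) \<longlonglongrightarrow> 0"
      using C g by (intro tendsto_div_of_bounded_error[where C = C]) simp
    moreover have "(\<lambda>n. \<Sum>u\<in>words k (Suc K). (f u - f (tl u)) * (real (occ u (?p n)) / real n))
        \<longlonglongrightarrow> (\<Sum>u\<in>words k (Suc K). (f u - f (tl u)) * asym_occ k u g)"
      by (intro tendsto_sum tendsto_mult tendsto_const asym_occ_tendsto g)
    ultimately have "(\<lambda>n. (f (?p n) - (\<Sum>u\<in>words k (Suc K). (f u - f (tl u)) * occ u (?p n))) / real n +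
        (\<Sum>u\<in>words k (Suc K). (f u - f (tl u)) * (real (occ u (?p n)) / real n)))
        \<longlonglongrightarrow> 0 + (\<Sum>u\<in>words k (Suc K). (f u - f (tl u)) * asym_occ k u g)"
      by (rule tendsto_add)
    moreover have "(f (?p n) - (\<Sum>u\<in>words k (Suc K). (f u - f (tl u)) * occ u (?p n))) / real n +
        (\<Sum>u\<in>words k (Suc K). (f u - f (tl u)) * (real (occ u (?p n)) / real n)) =
        real (occ v (\<phi> g [^]\<^bsub>free_group k\<^esub> n)) / real n" for n
      by (simp add: diff_divide_distrib sum_divide_distrib f_def \<phi>_pow[OF g])
    ultimately have "(\<lambda>n. real (occ v (\<phi> g [^]\<^bsub>free_group k\<^esub> n)) / real n)
        \<longlonglongrightarrow> (\<Sum>u\<in>words k (Suc K). (f u - f (tl u)) * asym_occ k u g)"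
      by (simp only: add_0_left)
    from LIMSEQ_unique[OF asym_occ_tendsto[OF \<phi>_closed[OF g]] this] show ?thesis .
  qed
  then show ?thesis by (rule that)
qed

lemma asym_occ_Nil_image:
  obtains M where "M > 0" "\<And>g. g \<in> reduced_words k \<Longrightarrow> asym_occ k [] g \<le> M * asym_occ k [] (\<phi> g)"
proof -
  obtain M where M: "M \<ge> 1" "\<And>g. g \<in> reduced_words k \<Longrightarrow> length (\<psi> g) \<le> M * length g"
    using hom_lipschitz[OF hom_\<psi>] by blast
  have "asym_occ k [] g \<le> real M * asym_occ k [] (\<phi> g)" if g: "g \<in> reduced_words k" for g
  proof (rule LIMSEQ_le[OF asym_occ_tendsto[OF g] tendsto_mult[OF tendsto_const asym_occ_tendsto[OF \<phi>_closed[OF g]]]])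
    have "real (occ [] (g [^]\<^bsub>free_group k\<^esub> n)) / real n
        \<le> real M * (real (occ [] (\<phi> g [^]\<^bsub>free_group k\<^esub> n)) / real n)" for n
    proof -
      have "length (g [^]\<^bsub>free_group k\<^esub> n) \<le> M * length (\<phi> g [^]\<^bsub>free_group k\<^esub> n)"
        using M(2)[of "\<phi> (g [^]\<^bsub>free_group k\<^esub> n)"] \<psi>_\<phi>[of "g [^]\<^bsub>free_group k\<^esub> n"] g by (simp add: \<phi>_pow)
      \<comment> \<open>\<open>occ []\<close> exceeds the length by one on both sides;
        \<open>M \<ge> 1\<close> absorbs the shift.\<close>
      then have "occ [] (g [^]\<^bsub>free_group k\<^esub> n) \<le> M * occ [] (\<phi> g [^]\<^bsub>free_group k\<^esub> n)"
        using M(1) by simp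
      then have "real (occ [] (g [^]\<^bsub>free_group k\<^esub> n)) \<le> real M * real (occ [] (\<phi> g [^]\<^bsub>free_group k\<^esub> n))"
        by (metis of_nat_mono of_nat_mult)
      then show ?thesis
        using divide_right_mono[of _ _ "real n"] by (metis of_nat_0_le_iff times_divide_eq_right)
    qed
    then show "\<exists>N. \<forall>n\<ge>N. real (occ [] (g [^]\<^bsub>free_group k\<^esub> n)) / real n
        \<le> real M * (real (occ [] (\<phi> g [^]\<^bsub>free_group k\<^esub> n)) / real n)"
      by blast
  qed
  with M(1) that[of "real M"] show ?thesis by simp
qed

end

section \<open>Outer automorphisms\<close>

context group
begin

lemma conj_class_trans:
  assumes "x \<in> carrier G" "y \<in> conj_class G x" "z \<in> conj_class G y"
  shows "z \<in> conj_class G x"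
proof -
  obtain a b where ab: "a \<in> carrier G" "b \<in> carrier G" "y = a \<otimes> x \<otimes> inv a" "z = b \<otimes> y \<otimes> inv b"
    using assms by (auto simp: conj_class_def)
  then have "z = (b \<otimes> a) \<otimes> x \<otimes> inv (b \<otimes> a)"
    using assms(1) by (simp add: m_assoc inv_mult_group)
  with ab show ?thesis
    unfolding conj_class_def by (intro image_eqI[of _ _ "b \<otimes> a"]) simp_all
qed

lemma conj_class_sym:
  assumes "x \<in> carrier G" "y \<in> conj_class G x"
  shows "x \<in> conj_class G y"
proof -
  obtain a where a: "a \<in> carrier G" "y = a \<otimes> x \<otimes> inv a"
    using assms by (auto simp: conj_class_def)
  then have "x = inv a \<otimes> y \<otimes> inv (inv a)"
    using assms(1) by (simp add: m_assoc inv_cancel)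
  with a(1) show ?thesis
    unfolding conj_class_def by (intro image_eqI[of _ _ "inv a"]) simp_all
qed

lemma conj_class_hom:
  assumes "\<phi> \<in> hom G G" "x \<in> carrier G" "y \<in> conj_class G x"
  shows "\<phi> y \<in> conj_class G (\<phi> x)"
proof -
  interpret \<phi>: group_hom G G \<phi>
    using assms(1) by unfold_locales
  show ?thesis
    using assms(2,3) by (auto simp: conj_class_def)
qed

lemma mult_AutoGroup:
  "f \<in> auto G \<Longrightarrow> g \<in> auto G \<Longrightarrow> f \<otimes>\<^bsub>AutoGroup G\<^esub> g = compose (carrier G) f g"
  by (simp add: AutoGroup_def BijGroup_def auto_def)

lemma carrier_AutoGroup [simp]: "carrier (AutoGroup G) = auto G"
  by (simp add: AutoGroup_def)

lemma conjugation_in_auto: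
  assumes "g \<in> carrier G"
  shows "(\<lambda>x\<in>carrier G. g \<otimes> x \<otimes> inv g) \<in> auto G"
proof -
  have inv: "inv a \<otimes> (a \<otimes> x \<otimes> inv a) \<otimes> inv (inv a) = x" if "a \<in> carrier G" "x \<in> carrier G" for a x
    using that by (simp add: m_assoc inv_cancel)
  have "(\<lambda>x\<in>carrier G. g \<otimes> x \<otimes> inv g) \<in> hom G G"
  proof (rule homI)
    fix x y assume xy: "x \<in> carrier G" "y \<in> carrier G"
    with assms show "(\<lambda>x\<in>carrier G. g \<otimes> x \<otimes> inv g) (x \<otimes> y) =
        (\<lambda>x\<in>carrier G. g \<otimes> x \<otimes> inv g) x \<otimes> (\<lambda>x\<in>carrier G. g \<otimes> x \<otimes> inv g) y"
      by (simp add: m_assoc inv_cancel)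
  qed (use assms in simp)
  moreover have "bij_betw (\<lambda>x\<in>carrier G. g \<otimes> x \<otimes> inv g) (carrier G) (carrier G)"
    by (rule bij_betw_byWitness[where f' = "\<lambda>x\<in>carrier G. inv g \<otimes> x \<otimes> inv (inv g)"])
       (use assms inv[of g] inv[of "inv g"] in auto)
  ultimately show ?thesis
    by (simp add: auto_def Bij_def)
qed

lemma conjugation_hom_AutoGroup:
  "(\<lambda>g. \<lambda>x\<in>carrier G. g \<otimes> x \<otimes> inv g) \<in> hom G (AutoGroup G)"
proof (rule homI)
  fix a b assume ab: "a \<in> carrier G" "b \<in> carrier G"
  show "(\<lambda>x\<in>carrier G. a \<otimes> b \<otimes> x \<otimes> inv (a \<otimes> b)) =
      (\<lambda>x\<in>carrier G. a \<otimes> x \<otimes> inv a) \<otimes>\<^bsub>AutoGroup G\<^esub> (\<lambda>x\<in>carrier G. b \<otimes> x \<otimes> inv b)"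
    using ab by (simp add: mult_AutoGroup conjugation_in_auto)
      (auto simp: compose_def m_assoc inv_mult_group)
qed (simp add: conjugation_in_auto)

lemma inner_auto_normal: "inner_auto G \<lhd> AutoGroup G"
proof -
  interpret A: group "AutoGroup G" by (rule AutoGroup)
  interpret c: group_hom G "AutoGroup G" "\<lambda>g. \<lambda>x\<in>carrier G. g \<otimes> x \<otimes> inv g"
    using conjugation_hom_AutoGroup by unfold_locales
  have sub: "subgroup (inner_auto G) (AutoGroup G)"
    unfolding inner_auto_def by (rule c.img_is_subgroup)
  have "\<phi> \<otimes>\<^bsub>AutoGroup G\<^esub> h \<otimes>\<^bsub>AutoGroup G\<^esub> inv\<^bsub>AutoGroup G\<^esub> \<phi> \<in> inner_auto G"
    if \<phi>: "\<phi> \<in> auto G" and h: "h \<in> inner_auto G" for \<phi> h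
  proof -
    obtain a where a: "a \<in> carrier G" "h = (\<lambda>x\<in>carrier G. a \<otimes> x \<otimes> inv a)"
      using h by (auto simp: inner_auto_def)
    interpret \<phi>: group_hom G G \<phi>
      using \<phi> by unfold_locales (simp add: auto_def)
    let ?h' = "\<lambda>x\<in>carrier G. \<phi> a \<otimes> x \<otimes> inv (\<phi> a)"
    have h': "?h' \<in> inner_auto G" "?h' \<in> auto G" "h \<in> auto G"
      using a by (auto simp: inner_auto_def conjugation_in_auto)
    \<comment> \<open>Conjugation by \<open>a\<close> followed by \<phi> is \<phi> followed by
      conjugation by the image of \<open>a\<close>; so conjugating an inner automorphism gives an
      inner one.\<close>
    have "\<phi> \<otimes>\<^bsub>AutoGroup G\<^esub> h = ?h' \<otimes>\<^bsub>AutoGroup G\<^esub> \<phi>"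
      using \<phi> h' a by (simp add: mult_AutoGroup) (auto simp: compose_def)
    then have "\<phi> \<otimes>\<^bsub>AutoGroup G\<^esub> h \<otimes>\<^bsub>AutoGroup G\<^esub> inv\<^bsub>AutoGroup G\<^esub> \<phi> = ?h'"
      using \<phi> h' A.inv_closed[of \<phi>] by (simp add: A.m_assoc)
    then show ?thesis using h' by simp
  qed
  then show ?thesis
    using sub by (auto simp: A.normal_inv_iff)
qed

lemma group_Out: "group (Out G)"
  unfolding Out_def by (rule normal.factorgroup_is_group[OF inner_auto_normal])

text \<open>Allows a coset to be handled through any representative: its members differ by inner
  automorphisms, hence at each element by a conjugation, which the rates do not see.\<close>

lemma Out_elem:
  assumes "\<Phi> \<in> carrier (Out G)"
  shows "\<Phi> \<noteq> {}" and "\<Phi> \<subseteq> auto G"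
    and "\<phi> \<in> \<Phi> \<Longrightarrow> \<psi> \<in> \<Phi> \<Longrightarrow> x \<in> carrier G \<Longrightarrow> \<phi> x \<in> conj_class G (\<psi> x)"
proof -
  interpret A: group "AutoGroup G" by (rule AutoGroup)
  have N: "subgroup (inner_auto G) (AutoGroup G)"
    by (rule normal_imp_subgroup[OF inner_auto_normal])
  have Ns: "inner_auto G \<subseteq> auto G"
    using subgroup.subset[OF N] by simp
  obtain \<phi>0 where \<phi>0: "\<phi>0 \<in> auto G" "\<Phi> = inner_auto G #>\<^bsub>AutoGroup G\<^esub> \<phi>0"
    using assms by (auto simp: Out_def FactGroup_def RCOSETS_def)
  show "\<Phi> \<noteq> {}"
    using \<phi>0 A.rcos_self[OF _ N] by auto
  show sub: "\<Phi> \<subseteq> auto G"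
    unfolding \<phi>0(2) using A.r_coset_subset_G[of "inner_auto G" \<phi>0] Ns \<phi>0(1)
    by (metis carrier_AutoGroup)
  have conj0: "\<phi> x \<in> conj_class G (\<phi>0 x)" if \<phi>: "\<phi> \<in> \<Phi>" and x: "x \<in> carrier G" for \<phi> x
  proof -
    obtain h where h: "h \<in> inner_auto G" "\<phi> = h \<otimes>\<^bsub>AutoGroup G\<^esub> \<phi>0"
      using \<phi> unfolding \<phi>0(2) r_coset_def by blast
    then obtain a where a: "a \<in> carrier G" "h = (\<lambda>x\<in>carrier G. a \<otimes> x \<otimes> inv a)"
      by (auto simp: inner_auto_def)
    have "h \<in> auto G"
      using h Ns by blast
    moreover have "\<phi>0 x \<in> carrier G"
      using \<phi>0 x by (auto simp: auto_def hom_def)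
    ultimately have "\<phi> x = a \<otimes> \<phi>0 x \<otimes> inv a"
      using h a \<phi>0 x by (simp add: mult_AutoGroup compose_def)
    then show ?thesis
      using a by (auto simp: conj_class_def)
  qed
  show "\<phi> x \<in> conj_class G (\<psi> x)" if "\<phi> \<in> \<Phi>" "\<psi> \<in> \<Phi>" "x \<in> carrier G"
  proof -
    have "\<psi> x \<in> carrier G" "\<phi>0 x \<in> carrier G"
      using that \<phi>0 sub by (auto simp: auto_def hom_def)
    then show ?thesis
      using conj_class_trans[OF _ conj_class_sym conj0] conj0 that by simp
  qed
qed

text \<open>The composite of arbitrary representatives represents the product, which reduces the
  action law to an evaluation on words.\<close>

lemma Out_mult:
  assumes "\<Phi> \<in> carrier (Out G)" "\<Psi> \<in> carrier (Out G)" "\<phi> \<in> \<Phi>" "\<psi> \<in> \<Psi>"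
  shows "compose (carrier G) \<phi> \<psi> \<in> \<Phi> \<otimes>\<^bsub>Out G\<^esub> \<Psi>"
proof -
  have "\<phi> \<in> auto G" "\<psi> \<in> auto G"
    using assms Out_elem(2) by blast+
  then have "compose (carrier G) \<phi> \<psi> = \<phi> \<otimes>\<^bsub>AutoGroup G\<^esub> \<psi>"
    by (simp add: mult_AutoGroup)
  moreover have "\<phi> \<otimes>\<^bsub>AutoGroup G\<^esub> \<psi> \<in> \<Phi> <#>\<^bsub>AutoGroup G\<^esub> \<Psi>"
    unfolding set_mult_def using assms(3,4) by blast
  ultimately show ?thesis
    by (simp add: Out_def FactGroup_def)
qed

lemma Out_one: "(\<lambda>x\<in>carrier G. x) \<in> \<one>\<^bsub>Out G\<^esub>"
proof -
  have "\<one>\<^bsub>AutoGroup G\<^esub> = (\<lambda>x\<in>carrier G. x)"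
    by (simp add: AutoGroup_def BijGroup_def)
  then show ?thesis
    using subgroup.one_closed[OF normal_imp_subgroup[OF inner_auto_normal]] by (simp add: Out_def FactGroup_def)
qed

end

section \<open>Frequencies of cyclic words\<close>

lemma auto_retract:
  assumes "\<phi> \<in> auto (free_group k)"
  shows "free_group_retract k \<phi> (restrict (inv_into (reduced_words k) \<phi>) (reduced_words k))"
proof -
  interpret F: group "free_group k" by (rule group_free_group)
  have \<phi>: "\<phi> \<in> hom (free_group k) (free_group k)" "\<phi> \<in> Bij (reduced_words k)"
    using assms by (auto simp: auto_def)
  then have "restrict (inv_into (reduced_words k) \<phi>) (reduced_words k) \<in> hom (free_group k) (free_group k)"
    using F.restrict_inv_into_hom[of \<phi>] by simp
  moreover have "restrict (inv_into (reduced_words k) \<phi>) (reduced_words k) (\<phi> g) = g"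
    if "g \<in> reduced_words k" for g
    using \<phi>(2) that by (auto simp: Bij_def bij_betw_def)
  ultimately show ?thesis
    using \<phi>(1) by unfold_locales auto
qed

text \<open>This is \<alpha> of the conjugacy class of \<open>g\<close>, written with rates so that
  \<open>g\<close> may be any nontrivial reduced word and no cyclic representative has to be
  chosen.\<close>

definition freq_point :: "nat \<Rightarrow> word \<Rightarrow> nat \<Rightarrow> word \<Rightarrow> real" where
  "freq_point k g = (\<lambda>m. \<lambda>v\<in>words k m. asym_occ k v g / asym_occ k [] g)"

lemma words_0 [simp]: "words k 0 = {[]}"
  by (auto simp: words_def)

lemma Qset_extensional: "q \<in> Qset k m \<Longrightarrow> q \<in> extensional (words k m)"
  by (auto simp: Qset_def split: if_splits)

lemma topspace_freq_space:
  "topspace (freq_space k) = {q. (\<forall>m. q m \<in> Qset k m) \<and> (\<forall>m\<ge>1. Qproj k m (q m) = q (m - 1))}"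
proof -
  have "topspace (Qtop k m) = Qset k m" for m
    using Qset_extensional by (auto simp: Qtop_def PiE_UNIV_domain PiE_def)
  then show ?thesis
    by (auto simp: freq_space_def PiE_UNIV_domain)
qed

lemma freq_point_in_freq_space:
  assumes g: "g \<in> reduced_words k" "g \<noteq> []"
  shows "freq_point k g \<in> topspace (freq_space k)"
proof -
  have pos: "0 < asym_occ k [] g"
    using asym_occ_Nil_pos[OF g] .
  have snoc: "(\<Sum>x | x \<in> letters k \<and> u @ [x] \<in> words k (Suc m). freq_point k g (Suc m) (u @ [x])) =
      asym_occ k u g / asym_occ k [] g" if "u \<in> words k m" for u m
    using asym_occ_sum_snoc[OF g(1) that] by (simp add: freq_point_def flip: sum_divide_distrib)
  have cons: "(\<Sum>x | x \<in> letters k \<and> x # u \<in> words k (Suc m). freq_point k g (Suc m) (x # u)) =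
      asym_occ k u g / asym_occ k [] g" if "u \<in> words k m" for u m
    using asym_occ_sum_Cons[OF g(1) that] by (simp add: freq_point_def flip: sum_divide_distrib)
  have "freq_point k g m \<in> Qset k m" for m
  proof (cases m)
    case 0
    then show ?thesis
      using pos by (auto simp: Qset_def freq_point_def)
  next
    case (Suc m')
    have "(\<Sum>v\<in>words k m. freq_point k g m v) = 1"
      using pos asym_occ_sum_words[OF g(1), of m] by (simp add: freq_point_def flip: sum_divide_distrib)
    moreover have "\<forall>v\<in>words k m. 0 \<le> freq_point k g m v"
      using pos asym_occ_nonneg[OF g(1)] by (simp add: freq_point_def)
    ultimately show ?thesis
      using snoc[of _ m'] cons[of _ m'] by (simp add: Qset_def Suc) (simp add: freq_point_def)
  qed
  moreover have "Qproj k m (freq_point k g m) = freq_point k g (m - 1)" if m: "m \<ge> 1" for m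
  proof -
    obtain m' where "m = Suc m'"
      using m by (cases m) auto
    then show ?thesis
      using snoc[of _ m'] by (auto simp: Qproj_def freq_point_def[of k g] restrict_def)
  qed
  ultimately show ?thesis
    by (simp add: topspace_freq_space)
qed

lemma asym_occ_conj_class:
  "g \<in> reduced_words k \<Longrightarrow> h \<in> conj_class (free_group k) g \<Longrightarrow> asym_occ k v h = asym_occ k v g"
  by (auto simp: conj_class_def asym_occ_conj)

lemma asym_occ_Nil_Nil: "asym_occ k [] [] = 0"
proof (rule asym_occ_eqI)
  fix n :: nat
  have "[] [^]\<^bsub>free_group k\<^esub> n = []"
    using monoid.nat_pow_one[OF group.is_monoid[OF group_free_group], of k n]
    by (simp add: one_free_group)
  then show "\<bar>real (occ [] ([] [^]\<^bsub>free_group k\<^esub> n)) - real n * 0\<bar> \<le> 1" by simp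
qed

text \<open>Rates are conjugacy invariants, so the choice made by \<open>SOME\<close> in
  \<open>frequency\<close> is immaterial. The form with a nonempty set of cyclically reduced
  conjugates of \<open>g\<close> covers both \<open>cyclic_class w\<close> and the values of
  \<open>cyclic_act\<close>.\<close>

lemma freq_map_eq_freq_point:
  assumes "c \<noteq> {}" "c \<subseteq> cyclically_reduced_words k" "g \<in> reduced_words k" "g \<noteq> []"
    and "c \<subseteq> conj_class (free_group k) g"
  shows "freq_map k c = freq_point k g"
proof -
  define x where "x = (SOME x. x \<in> c)"
  have "x \<in> c"
    unfolding x_def using assms(1) by (simp add: some_in_eq)
  then have x: "x \<in> cyclically_reduced_words k" "\<And>v. asym_occ k v x = asym_occ k v g"
    using assms asym_occ_conj_class[OF assms(3)] by auto
  have "x \<noteq> []"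
    using x(2)[of "[]"] asym_occ_Nil_pos[OF assms(3,4)] asym_occ_Nil_Nil[of k] by auto
  then have occ: "real (occurrences x v) = asym_occ k v g" for v
    using asym_occ_cyclically_reduced[OF x(1)] x(2) by simp
  have "frequency c v = asym_occ k v g / asym_occ k [] g" for v
    unfolding frequency_def cyclic_occ_def cyclic_length_def x_def[symmetric]
    using occ[of v] occ[of "[]"] by simp
  then show ?thesis
    by (simp add: freq_map_def freq_point_def)
qed

text \<open>Moving the first letter to the end is conjugation by the inverse of that letter.\<close>

lemma rotate1_conj:
  assumes "w \<in> cyclically_reduced_words k"
  shows "rotate1 w \<in> cyclically_reduced_words k"
    and "rotate1 w \<in> conj_class (free_group k) w"
proof -
  show "rotate1 w \<in> cyclically_reduced_words k"
  proof (cases w)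
    case (Cons x u)
    then show ?thesis
      using assms by (cases u) (auto simp: cyclically_reduced_words_def reduced_words_append reduced_words_Cons hd_append)
  qed (use assms in simp)
  then have red: "rotate1 w \<in> reduced_words k" "w \<in> reduced_words k"
    using assms by (auto simp: cyclically_reduced_words_def)
  show "rotate1 w \<in> conj_class (free_group k) w"
  proof (cases w)
    case Nil
    then show ?thesis
      using reduced_words_Nil[of k]
      by (auto simp: conj_class_def image_iff mult_free_group inv_free_group reduce_def intro!: bexI[of _ "[]"])
  next
    case (Cons x u)
    then have x: "[x] \<in> reduced_words k" "[letter_inv x] \<in> reduced_words k" "u \<in> reduced_words k"
      using red by (auto simp: reduced_words_Cons)
    have "[letter_inv x] \<otimes>\<^bsub>free_group k\<^esub> w = u"
      using reduce_word_inv_cancel[of u "[x]"] x Cons by (simp add: mult_free_group reduced_wordsD)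
    then have "rotate1 w = [letter_inv x] \<otimes>\<^bsub>free_group k\<^esub> w \<otimes>\<^bsub>free_group k\<^esub> inv\<^bsub>free_group k\<^esub> [letter_inv x]"
      using x red Cons by (simp add: mult_free_group inv_free_group reduce_ident reduced_wordsD)
    with x show ?thesis
      by (auto simp: conj_class_def)
  qed
qed

lemma cyclic_class_conj:
  assumes "w \<in> cyclically_reduced_words k"
  shows "cyclic_class w \<subseteq> cyclically_reduced_words k \<inter> conj_class (free_group k) w"
proof -
  interpret F: group "free_group k" by (rule group_free_group)
  have w: "w \<in> carrier (free_group k)"
    using assms by (simp add: cyclically_reduced_words_def)
  have "rotate n w \<in> cyclically_reduced_words k \<and> rotate n w \<in> conj_class (free_group k) w" for n
  proof (induction n)
    case 0
    have "w \<in> conj_class (free_group k) w"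
      using w F.r_one[OF w] F.one_closed by (auto simp: conj_class_def image_iff intro!: bexI[of _ "\<one>\<^bsub>free_group k\<^esub>"])
    with assms show ?case by simp
  next
    case (Suc n)
    then show ?case
      using rotate1_conj[of "rotate n w" k] F.conj_class_trans[OF w, of "rotate n w" "rotate1 (rotate n w)"]
      by simp
  qed
  then show ?thesis
    by (auto simp: cyclic_class_def)
qed

lemma freq_map_cyclic_class:
  assumes "w \<in> cyclically_reduced_words k" "w \<noteq> []"
  shows "freq_map k (cyclic_class w) = freq_point k w"
  using assms cyclic_class_conj[OF assms(1)]
  by (intro freq_map_eq_freq_point) (auto simp: cyclic_class_def cyclically_reduced_words_def)

lemma auto_nontrivial:
  assumes "\<phi> \<in> auto (free_group k)" "g \<in> reduced_words k" "g \<noteq> []"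
  shows "\<phi> g \<in> reduced_words k" "\<phi> g \<noteq> []"
proof -
  interpret free_group_retract k \<phi> "restrict (inv_into (reduced_words k) \<phi>) (reduced_words k)"
    by (rule auto_retract[OF assms(1)])
  show "\<phi> g \<in> reduced_words k"
    using assms by simp
  show "\<phi> g \<noteq> []"
    using assms \<psi>_\<phi>[of g] \<psi>_\<phi>[of "[]"] by auto
qed

text \<open>Changing the automorphism within its coset, or the word within its cyclic class, changes
  the image by a conjugation, so every member of the union is conjugate to \<phi>\<open>w\<close>. A
  cyclic reduction of \<phi>\<open>w\<close> shows that the set is not empty.\<close>

lemma freq_map_cyclic_act:
  assumes w: "w \<in> cyclically_reduced_words k" "w \<noteq> []"
    and \<Phi>: "\<Phi> \<in> carrier (Out (free_group k))" "\<phi> \<in> \<Phi>"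
  shows "freq_map k (cyclic_act k \<Phi> (cyclic_class w)) = freq_point k (\<phi> w)"
proof -
  interpret F: group "free_group k" by (rule group_free_group)
  have wr: "w \<in> reduced_words k"
    using w by (simp add: cyclically_reduced_words_def)
  have aut: "\<psi> \<in> auto (free_group k)" if "\<psi> \<in> \<Phi>" for \<psi>
    using F.Out_elem(2)[OF \<Phi>(1)] that by auto
  note \<phi>w = auto_nontrivial[OF aut[OF \<Phi>(2)] wr w(2)]
  show ?thesis
  proof (rule freq_map_eq_freq_point)
    show "cyclic_act k \<Phi> (cyclic_class w) \<subseteq> cyclically_reduced_words k"
      by (auto simp: cyclic_act_def)
    show "cyclic_act k \<Phi> (cyclic_class w) \<subseteq> conj_class (free_group k) (\<phi> w)"
    proof
      fix z assume "z \<in> cyclic_act k \<Phi> (cyclic_class w)"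
      then obtain \<psi> u where z: "\<psi> \<in> \<Phi>" "u \<in> cyclic_class w" "z \<in> conj_class (free_group k) (\<psi> u)"
        by (auto simp: cyclic_act_def)
      have "u \<in> conj_class (free_group k) w"
        using cyclic_class_conj[OF w(1)] z(2) by auto
      then have 1: "\<psi> u \<in> conj_class (free_group k) (\<psi> w)"
        using F.conj_class_hom[of \<psi> w u] aut[OF z(1)] wr by (simp add: auto_def)
      have 2: "\<psi> w \<in> conj_class (free_group k) (\<phi> w)"
        using F.Out_elem(3)[OF \<Phi>(1) z(1) \<Phi>(2)] wr by simp
      show "z \<in> conj_class (free_group k) (\<phi> w)"
        using F.conj_class_trans[OF _ F.conj_class_trans[OF _ 2 1] z(3)] \<phi>w by simp
    qed
    obtain a x where a: "a \<in> reduced_words k" "x \<in> cyclically_reduced_words k"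
        "\<phi> w = a \<otimes>\<^bsub>free_group k\<^esub> x \<otimes>\<^bsub>free_group k\<^esub> inv\<^bsub>free_group k\<^esub> a"
      using conj_cyclically_reduced[OF \<phi>w(1)] by blast
    have "w \<in> cyclic_class w"
      unfolding cyclic_class_def using rangeI[of "\<lambda>n. rotate n w" 0] by simp
    moreover have "\<phi> w \<in> conj_class (free_group k) x"
      unfolding conj_class_def using a(1,3) by (intro image_eqI[of _ _ a]) simp_all
    then have "x \<in> conj_class (free_group k) (\<phi> w)"
      using a(2) F.conj_class_sym[of x "\<phi> w"] by (simp add: cyclically_reduced_words_def)
    ultimately have "x \<in> cyclic_act k \<Phi> (cyclic_class w)"
      unfolding cyclic_act_def using a(2) \<Phi>(2) by blast
    then show "cyclic_act k \<Phi> (cyclic_class w) \<noteq> {}" by blast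
  qed (use \<phi>w in auto)
qed

lemma cyclic_words_rep:
  assumes "c \<in> cyclic_words k"
  obtains w where "w \<in> reduced_words k" "w \<noteq> []" "freq_map k c = freq_point k w"
    "\<And>\<Phi> \<phi>. \<Phi> \<in> carrier (Out (free_group k)) \<Longrightarrow> \<phi> \<in> \<Phi> \<Longrightarrow>
      freq_map k (cyclic_act k \<Phi> c) = freq_point k (\<phi> w)"
proof -
  obtain w where "w \<in> cyclically_reduced_words k" "w \<noteq> []" "c = cyclic_class w"
    using assms by (auto simp: cyclic_words_def)
  then show ?thesis
    using that[of w] freq_map_cyclic_class freq_map_cyclic_act
    by (auto simp: cyclically_reduced_words_def)
qed

text \<open>Every nontrivial element has a nontrivial cyclic reduction, so \<alpha>(C) is
  parametrised by all nontrivial reduced words, the form in which density and agreement of maps are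
  checked.\<close>

lemma freq_map_image: "freq_map k ` cyclic_words k = freq_point k ` (reduced_words k - {[]})"
proof (intro equalityI subsetI)
  fix q assume "q \<in> freq_map k ` cyclic_words k"
  then obtain c where c: "c \<in> cyclic_words k" "q = freq_map k c" by auto
  obtain w where "w \<in> reduced_words k" "w \<noteq> []" "freq_map k c = freq_point k w"
    by (rule cyclic_words_rep[OF c(1)]) blast
  then show "q \<in> freq_point k ` (reduced_words k - {[]})"
    unfolding c(2) by (intro image_eqI[of _ _ w]) simp_all
next
  fix q assume "q \<in> freq_point k ` (reduced_words k - {[]})"
  then obtain g where g: "g \<in> reduced_words k" "g \<noteq> []" "q = freq_point k g" by auto
  obtain a w where a: "a \<in> reduced_words k" "w \<in> cyclically_reduced_words k"
      "g = a \<otimes>\<^bsub>free_group k\<^esub> w \<otimes>\<^bsub>free_group k\<^esub> inv\<^bsub>free_group k\<^esub> a"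
    using conj_cyclically_reduced[OF g(1)] by blast
  have eq: "asym_occ k v g = asym_occ k v w" for v
    using a by (simp add: asym_occ_conj cyclically_reduced_words_def)
  then have "w \<noteq> []"
    using asym_occ_Nil_pos[OF g(1,2)] asym_occ_Nil_Nil[of k] by auto
  then have "q = freq_map k (cyclic_class w)"
    using g eq a by (simp add: freq_map_cyclic_class freq_point_def)
  with a \<open>w \<noteq> []\<close> show "q \<in> freq_map k ` cyclic_words k"
    by (auto simp: cyclic_words_def)
qed

text \<open>Divide the linear formula for the rates of \<phi>\<open>g\<close> by the length rate of
  \<open>g\<close>: it becomes a functional \<open>A v\<close> of the frequencies.
  \<open>A []\<close> is the factor by which \<phi> changes the cyclically reduced length, hence the
  lower bound \<open>1 / M\<close>.\<close>

lemma image_functionals: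
  assumes "\<phi> \<in> auto (free_group k)"
  obtains A :: "word \<Rightarrow> (nat \<Rightarrow> word \<Rightarrow> real) \<Rightarrow> real" and \<epsilon> where
    "\<And>v. \<exists>K \<delta>. A v = (\<lambda>q. \<Sum>u\<in>words k K. \<delta> u * q K u)"
    "\<And>g v. g \<in> reduced_words k \<Longrightarrow> g \<noteq> [] \<Longrightarrow> asym_occ k v (\<phi> g) = asym_occ k [] g * A v (freq_point k g)"
    "\<epsilon> > 0" "\<And>g. g \<in> reduced_words k \<Longrightarrow> g \<noteq> [] \<Longrightarrow> \<epsilon> \<le> A [] (freq_point k g)"
proof -
  interpret free_group_retract k \<phi> "restrict (inv_into (reduced_words k) \<phi>) (reduced_words k)"
    by (rule auto_retract[OF assms(1)])
  have "\<exists>K \<delta>. \<forall>g\<in>reduced_words k. asym_occ k v (\<phi> g) = (\<Sum>u\<in>words k K. \<delta> u * asym_occ k u g)" for v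
    using asym_occ_image[of v] by metis
  then obtain K \<delta> where K: "\<And>v g. g \<in> reduced_words k \<Longrightarrow>
      asym_occ k v (\<phi> g) = (\<Sum>u\<in>words k (K v). \<delta> v u * asym_occ k u g)"
    by metis
  define A where "A v q = (\<Sum>u\<in>words k (K v). \<delta> v u * q (K v) u)" for v and q :: "nat \<Rightarrow> word \<Rightarrow> real"
  have A: "asym_occ k v (\<phi> g) = asym_occ k [] g * A v (freq_point k g)"
    if "g \<in> reduced_words k" "g \<noteq> []" for g v
    using asym_occ_Nil_pos[OF that] that by (simp add: K A_def freq_point_def sum_distrib_left)
  obtain M where M: "M > 0" "\<And>g. g \<in> reduced_words k \<Longrightarrow> asym_occ k [] g \<le> M * asym_occ k [] (\<phi> g)"
    using asym_occ_Nil_image by blast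
  have "1 / M \<le> A [] (freq_point k g)" if g: "g \<in> reduced_words k" "g \<noteq> []" for g
    using M(2)[OF g(1)] M(1) asym_occ_Nil_pos[OF g] unfolding A[OF g]
    by (simp add: field_simps)
  then show ?thesis
    using that[of A "1 / M"] A M(1) by (auto simp: A_def fun_eq_iff)
qed

text \<open>A frequency of \<phi>\<open>g\<close> is the quotient of \<open>A v\<close> and
  \<open>A []\<close> at the frequency point of \<open>g\<close>. The length of \<open>g\<close>,
  which its frequencies do not determine, cancels; this is why the induced map is well
  defined.\<close>

lemma freq_point_image_cong:
  assumes "\<phi> \<in> auto (free_group k)" "g \<in> reduced_words k" "g \<noteq> []" "h \<in> reduced_words k" "h \<noteq> []"
    and "freq_point k g = freq_point k h"
  shows "freq_point k (\<phi> g) = freq_point k (\<phi> h)"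
proof -
  obtain A :: "word \<Rightarrow> (nat \<Rightarrow> word \<Rightarrow> real) \<Rightarrow> real" where
    A: "\<And>g v. g \<in> reduced_words k \<Longrightarrow> g \<noteq> [] \<Longrightarrow>
      asym_occ k v (\<phi> g) = asym_occ k [] g * A v (freq_point k g)"
    using image_functionals[OF assms(1)] by metis
  show ?thesis
    using asym_occ_Nil_pos[OF assms(2,3)] asym_occ_Nil_pos[OF assms(4,5)] assms(2-)
    by (simp add: freq_point_def[of k "\<phi> g"] freq_point_def[of k "\<phi> h"] A)
qed

lemma tilde_freq_point:
  assumes \<Phi>: "\<Phi> \<in> carrier (Out (free_group k))" "\<phi> \<in> \<Phi>"
    and g: "g \<in> reduced_words k" "g \<noteq> []"
  shows "tilde k \<Phi> (freq_point k g) = freq_point k (\<phi> g)"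
proof -
  interpret F: group "free_group k" by (rule group_free_group)
  define c where "c = (SOME c. c \<in> cyclic_words k \<and> freq_map k c = freq_point k g)"
  have "freq_point k g \<in> freq_map k ` cyclic_words k"
    unfolding freq_map_image using g by blast
  then have "\<exists>c. c \<in> cyclic_words k \<and> freq_map k c = freq_point k g"
    by (auto simp: image_iff)
  from someI_ex[OF this] have c: "c \<in> cyclic_words k" "freq_map k c = freq_point k g"
    unfolding c_def by auto
  obtain w where w: "w \<in> reduced_words k" "w \<noteq> []" "freq_map k c = freq_point k w"
      "freq_map k (cyclic_act k \<Phi> c) = freq_point k (\<phi> w)"
    by (rule cyclic_words_rep[OF c(1)]) (use \<Phi> in blast)
  have "\<phi> \<in> auto (free_group k)"
    using F.Out_elem(2)[OF \<Phi>(1)] \<Phi>(2) by blast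
  then have "freq_point k (\<phi> w) = freq_point k (\<phi> g)"
    using w c g freq_point_image_cong[of \<phi> k w g] by simp
  then show ?thesis
    unfolding tilde_def c_def[symmetric] w(4) .
qed

section \<open>Density\<close>

text \<open>The rank enters here: there are at least four letters, and only two are
  excluded.\<close>

lemma bridge_letter:
  assumes "k \<ge> 2"
  obtains b where "b \<in> letters k" "b \<noteq> x" "b \<noteq> y"
proof -
  have "card (letters k) \<ge> 4"
    using assms by (simp add: letters_def card_cartesian_product)
  moreover have "card {x, y} \<le> 2"
    by (simp add: card_insert_if)
  ultimately have "\<not> letters k \<subseteq> {x, y}"
    using card_mono[of "{x, y}" "letters k"] by fastforce
  then show ?thesis using that by blast
qed

lemma bridge:
  assumes "k \<ge> 2" "a \<in> reduced_words k" "c \<in> reduced_words k"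
  obtains b where "a @ b # c \<in> reduced_words k"
proof -
  obtain b where b: "b \<in> letters k" "b \<noteq> letter_inv (last a)" "b \<noteq> letter_inv (hd c)"
    using bridge_letter[OF assms(1)] by blast
  then have "hd c \<noteq> letter_inv b" by auto
  with b assms show ?thesis
    by (intro that[of b]) (simp add: reduced_words_append reduced_words_Cons)
qed

lemma close_up:
  assumes "k \<ge> 2" "g \<in> reduced_words k"
  obtains b where "g @ [b] \<in> cyclically_reduced_words k"
proof -
  \<comment> \<open>\<open>b\<close> avoids cancellation at the end of \<open>g\<close> and across
    the cyclic junction. For empty \<open>g\<close> the excluded letters are unspecified, and the
    junction is harmless because no letter is its own inverse.\<close>
  obtain b where b: "b \<in> letters k" "b \<noteq> letter_inv (last g)" "b \<noteq> letter_inv (hd g)"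
    using bridge_letter[OF assms(1)] by blast
  then have "hd g \<noteq> letter_inv b" by auto
  with b assms letter_inv_neq[of b] show ?thesis
    by (intro that[of b])
      (auto simp: cyclically_reduced_words_def reduced_words_append reduced_words_Cons hd_append)
qed

text \<open>Flow conservation on the graph with vertices \<open>words k m\<close> and edges
  \<open>words k (Suc m)\<close>, where the edge \<open>v\<close> runs from \<open>butlast v\<close>
  to \<open>tl v\<close>: the left sum is the flow out of \<open>u\<close>, the right sum the flow
  into \<open>u\<close>.\<close>

definition balanced :: "nat \<Rightarrow> nat \<Rightarrow> (word \<Rightarrow> real) \<Rightarrow> bool" where
  "balanced k m f \<longleftrightarrow> (\<forall>u\<in>words k m.
    (\<Sum>x | x \<in> letters k \<and> u @ [x] \<in> words k (Suc m). f (u @ [x])) =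
    (\<Sum>y | y \<in> letters k \<and> y # u \<in> words k (Suc m). f (y # u)))"

lemma occurrences_balanced:
  assumes "w \<in> cyclically_reduced_words k" "w \<noteq> []"
  shows "balanced k m (\<lambda>v. real (occurrences w v))"
  using asym_occ_sum_snoc[of w k _ m] asym_occ_sum_Cons[of w k _ m] assms
  by (simp add: balanced_def cyclically_reduced_words_def flip: asym_occ_cyclically_reduced[OF assms])

lemma occurrences_sum_words:
  assumes "w \<in> cyclically_reduced_words k" "w \<noteq> []"
  shows "(\<Sum>v\<in>words k m. real (occurrences w v)) = length w"
  using asym_occ_sum_words[of w k m] assms
  by (simp add: asym_occ_cyclically_reduced[OF assms] cyclically_reduced_words_def)

text \<open>A positive edge makes the inflow at its end positive, so by conservation some positive
  edge leaves that vertex. Following such edges in a finite graph eventually repeats, and the first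
  letters along the closed walk spell the cyclic word.\<close>

lemma cycle_in_support:
  assumes f: "\<And>v. v \<in> words k (Suc m) \<Longrightarrow> 0 \<le> f v" "balanced k m f"
    and "m \<ge> 1" "e \<in> words k (Suc m)" "0 < f e"
  obtains w where "w \<in> cyclically_reduced_words k" "w \<noteq> []"
    "\<And>v. v \<in> words k (Suc m) \<Longrightarrow> 0 < occurrences w v \<Longrightarrow> 0 < f v"
proof -
  define S where "S = {v \<in> words k (Suc m). 0 < f v}"
  have ex: "\<exists>v'. v' \<in> S \<and> butlast v' = tl v" if v: "v \<in> S" for v
  proof -
    obtain y u where yu: "v = y # u"
      using v by (cases v) (auto simp: S_def words_def)
    have y: "y \<in> letters k" "u \<in> words k m" "y # u \<in> words k (Suc m)" "0 < f (y # u)"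
      using v by (auto simp: S_def words_def yu reduced_words_Cons)
    have "0 < f (y # u)" by fact
    also have "\<dots> \<le> (\<Sum>y | y \<in> letters k \<and> y # u \<in> words k (Suc m). f (y # u))"
      using y f(1) by (intro member_le_sum[of y _ "\<lambda>y. f (y # u)"]) auto
    also have "\<dots> = (\<Sum>x | x \<in> letters k \<and> u @ [x] \<in> words k (Suc m). f (u @ [x]))"
      using f(2) y by (simp add: balanced_def)
    finally obtain x where "x \<in> letters k" "u @ [x] \<in> words k (Suc m)" "0 < f (u @ [x])"
      using sum_nonpos[of "{x. x \<in> letters k \<and> u @ [x] \<in> words k (Suc m)}" "\<lambda>x. f (u @ [x])"]
      by (force simp: not_less[symmetric])
    then show ?thesis
      by (intro exI[of _ "u @ [x]"]) (simp add: S_def yu)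
  qed
  define nxt where "nxt v = (SOME v'. v' \<in> S \<and> butlast v' = tl v)" for v
  have nxt: "nxt v \<in> S" "butlast (nxt v) = tl v" if "v \<in> S" for v
    using someI_ex[OF ex[OF that]] by (auto simp: nxt_def)
  have orbit: "(nxt ^^ n) v \<in> S" if "v \<in> S" for n v
    by (induction n) (use that nxt in auto)
  have "e \<in> S"
    using assms by (simp add: S_def)
  have "finite S"
    by (rule finite_subset[OF _ finite_words[of k "Suc m"]]) (auto simp: S_def)
  then have "finite (range (\<lambda>n. (nxt ^^ n) e))"
    by (rule finite_subset[rotated]) (use orbit[OF \<open>e \<in> S\<close>] in auto)
  then have "\<not> inj (\<lambda>n. (nxt ^^ n) e)"
    using finite_imageD by blast
  then obtain i j where ij: "i < j" "(nxt ^^ i) e = (nxt ^^ j) e"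
    unfolding inj_def by (metis nat_neq_iff)
  define v0 p where "v0 = (nxt ^^ i) e" and "p = j - i"
  have "(nxt ^^ (p + i)) e = (nxt ^^ i) e"
    using ij by (simp add: p_def)
  then have p: "p > 0" "(nxt ^^ p) v0 = v0"
    using ij(1) by (simp_all add: v0_def funpow_add) (simp add: p_def)
  define E where "E n = (nxt ^^ n) v0" for n
  have E: "E n \<in> S" "butlast (E (Suc n)) = tl (E n)" "E (n mod p) = E n" for n
    using orbit[OF orbit[OF \<open>e \<in> S\<close>]] nxt(2) funpow_mod_eq[OF p(2)] by (auto simp: E_def v0_def)
  have lenE: "length (E n) = Suc m" "E n \<in> reduced_words k" for n
    using E(1)[of n] by (auto simp: S_def words_def)
  define y where "y n = hd (E n)" for n
  \<comment> \<open>Consecutive edges overlap in \<open>m\<close> letters, so a whole edge can be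
    read off from the sequence of first letters.\<close>
  have window: "E n ! b = y (n + b)" if "b \<le> m" for n b
    using that
  proof (induction b arbitrary: n)
    case 0
    then show ?case
      using lenE[of n] by (cases "E n") (auto simp: y_def)
  next
    case (Suc b)
    then have "E n ! Suc b = tl (E n) ! b"
      using lenE[of n] by (simp add: nth_tl)
    also have "\<dots> = E (Suc n) ! b"
      using Suc.prems lenE[of "Suc n"] by (simp add: nth_butlast flip: E(2))
    also have "\<dots> = y (Suc n + b)"
      using Suc by simp
    finally show ?case by simp
  qed
  have y_mod: "y (n mod p) = y n" for n
    by (simp add: y_def E)
  have y_letters: "y n \<in> letters k" for n
    using lenE[of n] by (cases "E n") (auto simp: y_def reduced_words_Cons)
  \<comment> \<open>Here \<open>m \<ge> 1\<close> matters: an edge has at least two letters, so two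
    consecutive letters of the walk lie in one reduced word.\<close>
  have y_red: "y (Suc n) \<noteq> letter_inv (y n)" for n
  proof -
    obtain c d t where E3: "E n = c # d # t"
      using lenE(1)[of n] \<open>m \<ge> 1\<close> by (cases "E n"; cases "tl (E n)") auto
    then have "c = y n" "d = y (Suc n)"
      using window[of 0 n] window[of 1 n] \<open>m \<ge> 1\<close> by simp_all
    with E3 lenE(2)[of n] show ?thesis
      by (simp add: reduced_words_Cons)
  qed
  define w where "w = map y [0..<p]"
  have "successively (\<lambda>x y. y \<noteq> letter_inv x) w"
    unfolding w_def successively_conv_nth using y_red by simp
  moreover have "hd w \<noteq> letter_inv (last w)"
  proof -
    have "hd w = y p" "last w = y (p - 1)"
      using p(1) y_mod[of p] by (simp_all add: w_def hd_map last_map)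
    then show ?thesis
      using y_red[of "p - 1"] p(1) by simp
  qed
  ultimately have "w \<in> cyclically_reduced_words k"
    using y_letters by (auto simp: cyclically_reduced_words_def reduced_words_def freely_reduced_def w_def)
  moreover have "w \<noteq> []"
    using p(1) by (simp add: w_def)
  moreover have "0 < f v" if v: "v \<in> words k (Suc m)" and occ: "0 < occurrences w v" for v
  proof -
    have "{i. i < length w \<and> (\<forall>j<length v. w ! ((i + j) mod length w) = v ! j)} \<noteq> {}"
      using occ unfolding occurrences_def by (metis card.empty less_irrefl)
    then obtain i where i: "i < p" "\<And>j. j < Suc m \<Longrightarrow> w ! ((i + j) mod p) = v ! j"
      using v by (auto simp: w_def words_def)
    \<comment> \<open>An occurrence of \<open>v\<close> in the cyclic word is an edge of the closed
      walk, even if \<open>v\<close> is longer than the period, because \<open>y\<close> and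
      \<open>occurrences\<close> both wrap modulo \<open>p\<close>.\<close>
    have "v ! j = E i ! j" if "j < Suc m" for j
      using i(2)[OF that] p(1) that window[of j i] by (simp add: w_def y_mod)
    then have "v = E i"
      using v lenE(1)[of i] by (intro nth_equalityI) (auto simp: words_def)
    then show ?thesis
      using E(1)[of i] by (simp add: S_def)
  qed
  ultimately show ?thesis using that by blast
qed

text \<open>One error bound serves all multiples \<open>T\<close>, so division by \<open>T\<close>
  recovers \<open>f\<close>. The words are not cyclic and can be concatenated; roundings and
  junctions are absorbed by \<open>C\<close>.\<close>

definition realizable :: "nat \<Rightarrow> nat \<Rightarrow> (word \<Rightarrow> real) \<Rightarrow> bool" where
  "realizable k m f \<longleftrightarrow>
    (\<exists>C. \<forall>T::nat. \<exists>g\<in>reduced_words k. \<forall>v\<in>words k m. \<bar>real (occ v g) - real T * f v\<bar> \<le> C)"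

lemma realizable_add_cycle:
  fixes \<mu> :: real
  assumes k: "k \<ge> 2" and f: "realizable k m f" and "0 \<le> \<mu>"
    and w: "w \<in> cyclically_reduced_words k" "w \<noteq> []"
  shows "realizable k m (\<lambda>v. f v + \<mu> * occurrences w v)"
proof -
  obtain C where C: "\<And>T::nat. \<exists>g\<in>reduced_words k. \<forall>v\<in>words k m. \<bar>real (occ v g) - real T * f v\<bar> \<le> C"
    using f by (auto simp: realizable_def)
  \<comment> \<open>Append about \<open>T * \<mu>\<close> periods of \<open>w\<close> behind one
    joining letter. The errors are \<open>m + 1\<close> at the junction, 1 for the joining letter,
    \<open>m + 1\<close> for the ends of the repetition and \<open>length w\<close> for rounding the
    number of periods.\<close>
  have "\<exists>h\<in>reduced_words k. \<forall>v\<in>words k m.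
      \<bar>real (occ v h) - real T * (f v + \<mu> * occurrences w v)\<bar> \<le> C + 2 * m + 3 + length w" for T :: nat
  proof -
    obtain g where g: "g \<in> reduced_words k" "\<And>v. v \<in> words k m \<Longrightarrow> \<bar>real (occ v g) - real T * f v\<bar> \<le> C"
      using C by blast
    define n where "n = nat \<lfloor>real T * \<mu>\<rfloor>"
    have n: "\<bar>real n - real T * \<mu>\<bar> \<le> 1"
      using \<open>0 \<le> \<mu>\<close> unfolding n_def by (simp add: abs_le_iff) linarith
    let ?p = "concat (replicate n w)"
    obtain b where b: "g @ b # ?p \<in> reduced_words k"
      using bridge[OF k g(1) cyclic_powers(1)[OF w(1)]] by blast
    have "\<bar>real (occ v (g @ b # ?p)) - real T * (f v + \<mu> * occurrences w v)\<bar> \<le> C + 2 * m + 3 + length w"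
      if v: "v \<in> words k m" for v
    proof -
      have "length v = m"
        using v by (simp add: words_def)
      then have 1: "\<bar>real (occ v (g @ b # ?p)) - occ v g - occ v (b # ?p)\<bar> \<le> m + 1"
        using occ_append[of v g "b # ?p"] by simp
      have 2: "\<bar>real (occ v (b # ?p)) - occ v ?p\<bar> \<le> 1"
        using occ_append_left[of v "[b]" ?p] by simp
      have 3: "\<bar>real (occ v ?p) - real n * occurrences w v\<bar> \<le> m + 1"
        using occ_power[OF w(2), of v n] \<open>length v = m\<close> by simp
      have "occurrences w v \<le> card {..<length w}"
        unfolding occurrences_def by (rule card_mono) auto
      then have "\<bar>real n - real T * \<mu>\<bar> * occurrences w v \<le> 1 * real (length w)"
        using n by (intro mult_mono) auto
      then have 4: "\<bar>real n * occurrences w v - real T * \<mu> * occurrences w v\<bar> \<le> length w"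
        by (simp add: abs_mult flip: left_diff_distrib)
      have "real T * (f v + \<mu> * occurrences w v) = real T * f v + real T * \<mu> * occurrences w v"
        by (simp add: distrib_left)
      then show ?thesis
        using g(2)[OF v] 1 2 3 4 unfolding of_nat_add of_nat_mult of_nat_1 by linarith
    qed
    with b show ?thesis by blast
  qed
  then show ?thesis
    unfolding realizable_def by blast
qed

text \<open>Subtract from \<open>f\<close> the largest multiple of a cycle supported in the support of \<open>f\<close>
  that keeps it nonnegative; this makes the support smaller.\<close>

lemma balanced_realizable:
  assumes k: "k \<ge> 2" and m: "m \<ge> 1"
    and "\<And>v. v \<in> words k (Suc m) \<Longrightarrow> 0 \<le> f v" "balanced k m f"
  shows "realizable k (Suc m) f"
  using assms(3,4)
proof (induction "card {v \<in> words k (Suc m). 0 < f v}" arbitrary: f rule: less_induct)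
  case (less f)
  show ?case
  proof (cases "\<exists>e\<in>words k (Suc m). 0 < f e")
    case False
    then have zero: "f v = 0" if "v \<in> words k (Suc m)" for v
      using less.prems(1)[OF that] that False by force
    have "\<bar>real (occ v []) - real T * f v\<bar> \<le> 1" if "v \<in> words k (Suc m)" for v and T :: nat
      using zero[OF that] by simp
    then show ?thesis
      unfolding realizable_def using reduced_words_Nil[of k] by blast
  next
    case True
    then obtain w where w: "w \<in> cyclically_reduced_words k" "w \<noteq> []"
        and supp: "\<And>v. v \<in> words k (Suc m) \<Longrightarrow> 0 < occurrences w v \<Longrightarrow> 0 < f v"
      using cycle_in_support[OF less.prems m] by blast
    define S where "S = {v \<in> words k (Suc m). 0 < occurrences w v}"
    have "finite S"
      by (rule finite_subset[OF _ finite_words[of k "Suc m"]]) (auto simp: S_def)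
    have "S \<noteq> {}"
    proof
      assume "S = {}"
      then have "(\<Sum>v\<in>words k (Suc m). real (occurrences w v)) = 0"
        by (intro sum.neutral) (auto simp: S_def)
      then show False
        using occurrences_sum_words[OF w] w(2) by simp
    qed
    define \<epsilon> where "\<epsilon> = Min ((\<lambda>v. f v / occurrences w v) ` S)"
    have "\<epsilon> \<in> (\<lambda>v. f v / occurrences w v) ` S"
      unfolding \<epsilon>_def using \<open>finite S\<close> \<open>S \<noteq> {}\<close> by (intro Min_in) auto
    then obtain v0 where v0: "v0 \<in> S" "\<epsilon> = f v0 / occurrences w v0" by auto
    have "\<epsilon> \<ge> 0"
      using v0 supp[of v0] by (auto simp: S_def intro!: divide_nonneg_nonneg less_imp_le)
    have le: "\<epsilon> * occurrences w v \<le> f v" if v: "v \<in> words k (Suc m)" for v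
    proof (cases "v \<in> S")
      case True
      then have "\<epsilon> \<le> f v / occurrences w v"
        unfolding \<epsilon>_def using \<open>finite S\<close> by (intro Min_le) auto
      with True show ?thesis
        by (simp add: S_def pos_le_divide_eq)
    next
      case False
      then show ?thesis
        using less.prems(1)[OF v] v by (simp add: S_def)
    qed
    define f' where "f' v = f v - \<epsilon> * occurrences w v" for v
    have "{v \<in> words k (Suc m). 0 < f' v} \<subseteq> {v \<in> words k (Suc m). 0 < f v}"
    proof safe
      fix v assume "0 < f' v"
      moreover have "0 \<le> \<epsilon> * occurrences w v"
        using \<open>\<epsilon> \<ge> 0\<close> by simp
      ultimately show "0 < f v"
        by (simp add: f'_def)
    qed
    \<comment> \<open>At \<open>v0\<close>, where the minimal ratio is attained, nothing is left, so
      this edge drops out of the support.\<close>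
    moreover have "v0 \<in> {v \<in> words k (Suc m). 0 < f v}" "v0 \<notin> {v \<in> words k (Suc m). 0 < f' v}"
      using v0 supp[of v0] by (auto simp: S_def f'_def)
    ultimately have "card {v \<in> words k (Suc m). 0 < f' v} < card {v \<in> words k (Suc m). 0 < f v}"
      by (intro psubset_card_mono) auto
    moreover have "0 \<le> f' v" if "v \<in> words k (Suc m)" for v
      using le[OF that] by (simp add: f'_def)
    moreover have "balanced k m f'"
      using less.prems(2) occurrences_balanced[OF w, of m]
      by (simp add: balanced_def f'_def sum_subtractf flip: sum_distrib_left)
    ultimately have "realizable k (Suc m) f'"
      by (intro less.hyps) auto
    from realizable_add_cycle[OF k this \<open>\<epsilon> \<ge> 0\<close> w] show ?thesis
      by (simp add: f'_def)
  qed
qed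

section \<open>From flows to frequencies of cyclic words\<close>

lemma occ_cyclically_reduced:
  assumes "w \<in> cyclically_reduced_words k" "w \<noteq> []"
  shows "\<bar>real (occ v w) - asym_occ k v w\<bar> \<le> length v + 1"
  using occ_power[OF assms(2), of v 1] by (simp add: asym_occ_cyclically_reduced[OF assms])

text \<open>Realise \<open>T * f v\<close> by counts in a word and close it up by one letter. After
  division by \<open>T\<close> the rates tend to \<open>f\<close>; as \<open>f\<close> has total
  mass one, the lengths divided by \<open>T\<close> tend to 1, and so the normalised rates have the
  same limit.\<close>

lemma frequencies_dense:
  assumes k: "k \<ge> 2" and m: "m \<ge> 1"
    and f: "\<And>v. v \<in> words k (Suc m) \<Longrightarrow> 0 \<le> f v" "balanced k m f"
    and sum: "(\<Sum>v\<in>words k (Suc m). f v) = 1"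
  obtains G where "\<And>T::nat. G T \<in> reduced_words k - {[]}"
    "\<And>v. v \<in> words k (Suc m) \<Longrightarrow> (\<lambda>T. asym_occ k v (G T) / asym_occ k [] (G T)) \<longlonglongrightarrow> f v"
proof -
  let ?W = "words k (Suc m)"
  obtain C where C: "\<And>T::nat. \<exists>g\<in>reduced_words k. \<forall>v\<in>?W. \<bar>real (occ v g) - real T * f v\<bar> \<le> C"
    using balanced_realizable[OF k m f] by (auto simp: realizable_def)
  \<comment> \<open>In \<open>m + 3\<close>, one is for the closing letter and \<open>m + 2\<close>
    for comparing cyclic with linear counts of a word of length \<open>m + 1\<close>.\<close>
  have "\<exists>g. g \<in> cyclically_reduced_words k - {[]} \<and> (\<forall>v\<in>?W. \<bar>asym_occ k v g - real T * f v\<bar> \<le> C + m + 3)"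
    for T :: nat
  proof -
    obtain g where g: "g \<in> reduced_words k" "\<And>v. v \<in> ?W \<Longrightarrow> \<bar>real (occ v g) - real T * f v\<bar> \<le> C"
      using C by blast
    obtain b where b: "g @ [b] \<in> cyclically_reduced_words k"
      using close_up[OF k g(1)] by blast
    have "\<bar>asym_occ k v (g @ [b]) - real T * f v\<bar> \<le> C + m + 3" if v: "v \<in> ?W" for v
      using g(2)[OF v] occ_append_right[of v g "[b]"] occ_cyclically_reduced[OF b, of v] v
      by (simp add: words_def)
    with b show ?thesis by blast
  qed
  then obtain G where G: "\<And>T. G T \<in> cyclically_reduced_words k - {[]}"
      "\<And>T v. v \<in> ?W \<Longrightarrow> \<bar>asym_occ k v (G T) - real T * f v\<bar> \<le> C + m + 3"
    by metis
  have red: "G T \<in> reduced_words k - {[]}" for T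
    using G(1)[of T] by (simp add: cyclically_reduced_words_def)
  have lim: "(\<lambda>T. asym_occ k v (G T) / real T) \<longlonglongrightarrow> f v" if "v \<in> ?W" for v
    using G(2)[OF that] by (rule tendsto_div_of_bounded_error)
  have "(\<lambda>T. \<Sum>v\<in>?W. asym_occ k v (G T) / real T) \<longlonglongrightarrow> (\<Sum>v\<in>?W. f v)"
    using lim by (rule tendsto_sum)
  moreover have "(\<Sum>v\<in>?W. asym_occ k v (G T) / real T) = asym_occ k [] (G T) / real T" for T
    using asym_occ_sum_words[of "G T" k "Suc m"] red[of T] by (simp flip: sum_divide_distrib)
  ultimately have len: "(\<lambda>T. asym_occ k [] (G T) / real T) \<longlonglongrightarrow> 1"
    using sum by simp
  have "(\<lambda>T. asym_occ k v (G T) / asym_occ k [] (G T)) \<longlonglongrightarrow> f v" if v: "v \<in> ?W" for v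
  proof -
    have "(\<lambda>T. (asym_occ k v (G T) / real T) / (asym_occ k [] (G T) / real T)) \<longlonglongrightarrow> f v / 1"
      by (intro tendsto_divide lim[OF v] len) simp
    then have "(\<lambda>T. (asym_occ k v (G T) / real T) / (asym_occ k [] (G T) / real T)) \<longlonglongrightarrow> f v"
      by simp
    then show ?thesis
      by (rule Lim_transform_eventually) (rule eventually_sequentiallyI[of 1], simp)
  qed
  with red that show ?thesis by blast
qed

section \<open>The extension to the frequency space\<close>

lemma freq_space_memberD:
  assumes q: "q \<in> topspace (freq_space k)" and u: "u \<in> words k m"
  shows "(\<Sum>x | x \<in> letters k \<and> u @ [x] \<in> words k (Suc m). q (Suc m) (u @ [x])) = q m u"
    and "(\<Sum>y | y \<in> letters k \<and> y # u \<in> words k (Suc m). q (Suc m) (y # u)) = q m u"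
proof -
  have "Qproj k (Suc m) (q (Suc m)) = q m"
    using q by (auto simp: topspace_freq_space dest: spec[of _ "Suc m"])
  from fun_cong[OF this, of u] show
    "(\<Sum>x | x \<in> letters k \<and> u @ [x] \<in> words k (Suc m). q (Suc m) (u @ [x])) = q m u"
    using u by (simp add: Qproj_def)
  moreover have "q (Suc m) \<in> Qset k (Suc m)"
    using q by (simp add: topspace_freq_space)
  ultimately show "(\<Sum>y | y \<in> letters k \<and> y # u \<in> words k (Suc m). q (Suc m) (y # u)) = q m u"
    using u by (simp add: Qset_def)
qed

text \<open>Expresses membership by equalities and inequalities that involve finitely many
  coordinates each, ready for density arguments. Total mass one is carried by
  \<open>q 0 [] = 1\<close> and propagates upward through the projections.\<close>

lemma topspace_freq_space_iff:
  "q \<in> topspace (freq_space k) \<longleftrightarrow>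
    (\<forall>m. q m \<in> extensional (words k m)) \<and> q 0 [] = 1 \<and> (\<forall>m. \<forall>v\<in>words k m. 0 \<le> q m v) \<and>
    (\<forall>m. \<forall>u\<in>words k m.
      (\<Sum>x | x \<in> letters k \<and> u @ [x] \<in> words k (Suc m). q (Suc m) (u @ [x])) = q m u \<and>
      (\<Sum>y | y \<in> letters k \<and> y # u \<in> words k (Suc m). q (Suc m) (y # u)) = q m u)"
  (is "_ \<longleftrightarrow> ?R")
proof
  assume q: "q \<in> topspace (freq_space k)"
  then have Q: "q m \<in> Qset k m" for m
    by (simp add: topspace_freq_space)
  have "q 0 [] = 1"
    using Q[of 0] by (simp add: Qset_def)
  moreover have "0 \<le> q m v" if "v \<in> words k m" for m v
    using Q[of m] that by (auto simp: Qset_def split: if_splits)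
  ultimately show ?R
    using Q Qset_extensional freq_space_memberD[OF q] by blast
next
  assume R: ?R
  have sum: "(\<Sum>v\<in>words k m. q m v) = 1" for m
  proof (induction m)
    case (Suc m)
    then show ?case
      using R by (simp add: sum_words_Suc)
  qed (use R in simp)
  have "q m \<in> Qset k m" for m
  proof (cases m)
    case 0
    have "q 0 \<in> extensional (words k 0)"
      using R by blast
    then have "q 0 = (\<lambda>v\<in>words k 0. 1)"
      using R by (intro extensionalityI[of _ "words k 0"]) auto
    then show ?thesis
      using 0 by (simp add: Qset_def)
  next
    case (Suc m')
    then show ?thesis
      using R sum[of "Suc m'"] by (simp add: Qset_def)
  qed
  moreover have "Qproj k m (q m) = q (m - 1)" if "m \<ge> 1" for m
  proof -
    obtain m' where m: "m = Suc m'"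
      using \<open>m \<ge> 1\<close> by (cases m) auto
    show ?thesis
      unfolding m using R by (intro extensionalityI[of _ "words k m'"]) (auto simp: Qproj_def)
  qed
  ultimately show "q \<in> topspace (freq_space k)"
    by (simp add: topspace_freq_space)
qed

section \<open>Continuity, separation and convergence in the inverse limit\<close>

lemma continuous_map_coordinate:
  assumes "v \<in> words k m"
  shows "continuous_map (freq_space k) euclideanreal (\<lambda>q. q m v)"
proof -
  have "continuous_map (freq_space k) (Qtop k m) (\<lambda>q. q m)"
    unfolding freq_space_def
    by (rule continuous_map_from_subtopology, rule continuous_map_product_projection) simp
  moreover have "continuous_map (Qtop k m) euclideanreal (\<lambda>p. p v)"
    unfolding Qtop_def
    by (rule continuous_map_from_subtopology, rule continuous_map_product_projection) (rule assms)
  ultimately show ?thesis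
    using continuous_map_compose[of _ _ "\<lambda>q. q m" _ "\<lambda>p. p v"] by (simp add: o_def)
qed

lemma continuous_map_into_freq_space:
  assumes "\<And>x. x \<in> topspace X \<Longrightarrow> f x \<in> topspace (freq_space k)"
    and "\<And>m v. v \<in> words k m \<Longrightarrow> continuous_map X euclideanreal (\<lambda>x. f x m v)"
  shows "continuous_map X (freq_space k) f"
proof -
  have Q: "f x m \<in> Qset k m" if "x \<in> topspace X" for x m
    using assms(1)[OF that] by (simp add: topspace_freq_space)
  have "continuous_map X (Qtop k m) (\<lambda>x. f x m)" for m
    unfolding Qtop_def continuous_map_in_subtopology continuous_map_componentwise
    using Q Qset_extensional assms(2) by auto
  then show ?thesis
    unfolding freq_space_def continuous_map_in_subtopology continuous_map_componentwise_UNIV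
    using assms(1) by (auto simp: topspace_freq_space)
qed

lemma Hausdorff_freq_space: "Hausdorff_space (freq_space k)"
  unfolding freq_space_def Qtop_def
  by (intro Hausdorff_space_subtopology) (auto simp: Hausdorff_space_product_topology
      intro!: Hausdorff_space_subtopology)

lemma limitin_freq_space:
  assumes "\<And>n. f n \<in> topspace (freq_space k)" "q \<in> topspace (freq_space k)"
    and "\<And>m v. v \<in> words k m \<Longrightarrow> (\<lambda>n. f n m v) \<longlonglongrightarrow> q m v"
  shows "limitin (freq_space k) f q sequentially"
proof -
  have Q: "f n m \<in> Qset k m" "q m \<in> Qset k m" for n m
    using assms(1)[of n] assms(2) by (simp_all add: topspace_freq_space)
  have "limitin (Qtop k m) (\<lambda>n. f n m) (q m) sequentially" for m
    unfolding Qtop_def limitin_subtopology limitin_componentwise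
    using Q Qset_extensional assms(3) by (auto simp: PiE_UNIV_domain PiE_def)
  moreover have "topspace (Qtop k m) = Qset k m" for m
    using Qset_extensional by (auto simp: Qtop_def PiE_def)
  ultimately show ?thesis
    unfolding freq_space_def limitin_subtopology limitin_componentwise
    using Q assms(1,2) by (auto simp: topspace_freq_space PiE_UNIV_domain)
qed

lemma approximate_up_to_level:
  assumes k: "k \<ge> 2" and q: "q \<in> topspace (freq_space k)" and "\<epsilon> > 0"
  shows "\<exists>g\<in>reduced_words k - {[]}. \<forall>m\<le>M. \<forall>v\<in>words k m. \<bar>freq_point k g m v - q m v\<bar> < \<epsilon>"
proof -
  \<comment> \<open>A high level determines all lower ones by summation, so one level is
    approximated and the limits descend. It is \<open>M + 2\<close> since edges of length
    \<open>Suc m\<close> with \<open>m \<ge> 1\<close> are required, here with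
    \<open>m = Suc M\<close>.\<close>
  let ?N = "Suc (Suc M)"
  have "q ?N \<in> Qset k ?N"
    using q by (simp add: topspace_freq_space)
  then have Q: "(\<Sum>v\<in>words k ?N. q ?N v) = 1" "\<And>v. v \<in> words k ?N \<Longrightarrow> 0 \<le> q ?N v"
      "balanced k (Suc M) (q ?N)"
    by (auto simp: Qset_def balanced_def)
  obtain G where G: "\<And>T::nat. G T \<in> reduced_words k - {[]}"
    and lim: "\<And>v. v \<in> words k ?N \<Longrightarrow> (\<lambda>T. asym_occ k v (G T) / asym_occ k [] (G T)) \<longlonglongrightarrow> q ?N v"
    using frequencies_dense[OF k _ Q(2,3,1)] by auto
  have mem: "freq_point k (G T) \<in> topspace (freq_space k)" for T
    using G[of T] by (simp add: freq_point_in_freq_space)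
  have lims: "\<forall>v\<in>words k m. (\<lambda>T. freq_point k (G T) m v) \<longlonglongrightarrow> q m v" if "m \<le> ?N" for m
    using that
  proof (induction rule: inc_induct)
    case base
    then show ?case
      using lim by (simp add: freq_point_def)
  next
    case (step m)
    show ?case
    proof
      fix u assume u: "u \<in> words k m"
      have "(\<lambda>T. \<Sum>x | x \<in> letters k \<and> u @ [x] \<in> words k (Suc m). freq_point k (G T) (Suc m) (u @ [x]))
          \<longlonglongrightarrow> (\<Sum>x | x \<in> letters k \<and> u @ [x] \<in> words k (Suc m). q (Suc m) (u @ [x]))"
        using step.IH by (intro tendsto_sum) simp
      then show "(\<lambda>T. freq_point k (G T) m u) \<longlonglongrightarrow> q m u"
        unfolding freq_space_memberD(1)[OF mem u] freq_space_memberD(1)[OF q u] .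
    qed
  qed
  have "\<forall>\<^sub>F T in sequentially. \<forall>m\<in>{..M}. \<forall>v\<in>words k m. dist (freq_point k (G T) m v) (q m v) < \<epsilon>"
    using lims \<open>\<epsilon> > 0\<close> by (intro eventually_ball_finite ballI finite_words finite_atMost) (auto simp: tendsto_iff)
  then obtain T where "\<forall>m\<in>{..M}. \<forall>v\<in>words k m. dist (freq_point k (G T) m v) (q m v) < \<epsilon>"
    by (auto simp: eventually_sequentially)
  with G[of T] show ?thesis
    by (intro bexI[of _ "G T"]) (auto simp: dist_real_def)
qed

text \<open>Accuracy \<open>1 / (M + 1)\<close> on all levels up to \<open>M\<close> yields a
  sequence that converges in every coordinate, which is convergence in the inverse limit.\<close>

lemma freq_points_dense:
  assumes k: "k \<ge> 2" and q: "q \<in> topspace (freq_space k)"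
  shows "q \<in> freq_space k closure_of (freq_point k ` (reduced_words k - {[]}))"
proof -
  have "\<exists>g\<in>reduced_words k - {[]}. \<forall>m\<le>M. \<forall>v\<in>words k m.
      \<bar>freq_point k g m v - q m v\<bar> < inverse (real (Suc M))" for M
    by (rule approximate_up_to_level[OF k q]) simp
  then obtain g where g: "\<And>M. g M \<in> reduced_words k - {[]}"
      "\<And>M m v. m \<le> M \<Longrightarrow> v \<in> words k m \<Longrightarrow> \<bar>freq_point k (g M) m v - q m v\<bar> < inverse (real (Suc M))"
    by metis
  have "limitin (freq_space k) (\<lambda>M. freq_point k (g M)) q sequentially"
  proof (rule limitin_freq_space[OF _ q])
    show "freq_point k (g M) \<in> topspace (freq_space k)" for M
      using g(1)[of M] by (simp add: freq_point_in_freq_space)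
    show "(\<lambda>M. freq_point k (g M) m v) \<longlonglongrightarrow> q m v" if v: "v \<in> words k m" for m v
    proof -
      have "(\<lambda>M. freq_point k (g M) m v - q m v) \<longlonglongrightarrow> 0"
      proof (rule tendsto_0_le[where K = 1])
        show "\<forall>\<^sub>F M in sequentially. norm (freq_point k (g M) m v - q m v) \<le> norm (inverse (real (Suc M))) * 1"
          using g(2)[OF _ v] by (intro eventually_sequentiallyI[of m]) (simp add: less_imp_le)
      qed (rule LIMSEQ_inverse_real_of_nat)
      then show ?thesis by (simp add: LIM_zero_iff)
    qed
  qed
  then have lim: "\<exists>N. \<forall>n\<ge>N. freq_point k (g n) \<in> T" if "q \<in> T" "openin (freq_space k) T" for T
    using that by (simp add: limitin_sequentially)
  have "\<exists>y\<in>freq_point k ` (reduced_words k - {[]}). y \<in> T" if "q \<in> T" "openin (freq_space k) T" for T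
    using lim[OF that] g(1) by blast
  with q show ?thesis
    by (auto simp: in_closure_of)
qed

lemma eq_on_freq_space:
  assumes k: "k \<ge> 2" and "Hausdorff_space Y"
    and "continuous_map (freq_space k) Y f" "continuous_map (freq_space k) Y f'"
    and "\<And>g. g \<in> reduced_words k \<Longrightarrow> g \<noteq> [] \<Longrightarrow> f (freq_point k g) = f' (freq_point k g)"
    and "q \<in> topspace (freq_space k)"
  shows "f q = f' q"
  using forall_in_closure_of_eq[OF freq_points_dense[OF k assms(6)] assms(2-4)] assms(5) by auto

lemma ge_on_freq_space:
  assumes k: "k \<ge> 2" and f: "continuous_map (freq_space k) euclideanreal f"
    and ge: "\<And>g. g \<in> reduced_words k \<Longrightarrow> g \<noteq> [] \<Longrightarrow> c \<le> f (freq_point k g)"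
    and q: "q \<in> topspace (freq_space k)"
  shows "c \<le> f q"
proof (rule forall_in_closure_of[OF freq_points_dense[OF k q]])
  have "closedin (freq_space k) {q \<in> topspace (freq_space k). f q \<in> {c..}}"
    by (rule closedin_continuous_map_preimage[OF f]) simp
  then show "closedin (freq_space k) {q \<in> topspace (freq_space k). c \<le> f q}"
    by simp
qed (use ge in auto)

text \<open>Take the quotients of \<open>A v\<close> and \<open>A []\<close> as coordinates; the
  lower bound on \<open>A []\<close> extends from the dense set, so they are continuous everywhere.
  Each defining condition of the target space compares continuous functions and holds at the points
  \<open>freq_point k g\<close>, hence it holds at every \<open>q\<close>.\<close>

lemma extension_exists:
  assumes k: "k \<ge> 2" and \<phi>: "\<phi> \<in> auto (free_group k)"
  obtains h where "continuous_map (freq_space k) (freq_space k) h"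
    "\<And>g. g \<in> reduced_words k \<Longrightarrow> g \<noteq> [] \<Longrightarrow> h (freq_point k g) = freq_point k (\<phi> g)"
proof -
  obtain A :: "word \<Rightarrow> (nat \<Rightarrow> word \<Rightarrow> real) \<Rightarrow> real" and \<epsilon> where
    lin: "\<And>v. \<exists>K \<delta>. A v = (\<lambda>q. \<Sum>u\<in>words k K. \<delta> u * q K u)"
    and A: "\<And>g v. g \<in> reduced_words k \<Longrightarrow> g \<noteq> [] \<Longrightarrow>
      asym_occ k v (\<phi> g) = asym_occ k [] g * A v (freq_point k g)"
    and \<epsilon>: "\<epsilon> > 0" "\<And>g. g \<in> reduced_words k \<Longrightarrow> g \<noteq> [] \<Longrightarrow> \<epsilon> \<le> A [] (freq_point k g)"
    by (rule image_functionals[OF \<phi>]) (rule that)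
  have cont_A: "continuous_map (freq_space k) euclideanreal (A v)" for v
  proof -
    obtain K \<delta> where "A v = (\<lambda>q. \<Sum>u\<in>words k K. \<delta> u * q K u)"
      using lin by blast
    then show ?thesis
      by (auto intro!: continuous_map_sum continuous_map_real_mult continuous_map_coordinate)
  qed
  have pos: "\<epsilon> \<le> A [] q" if "q \<in> topspace (freq_space k)" for q
    using ge_on_freq_space[OF k cont_A \<epsilon>(2) that] .
  define h where "h q = (\<lambda>m. \<lambda>v\<in>words k m. A v q / A [] q)" for q
  have h: "h (freq_point k g) = freq_point k (\<phi> g)" if "g \<in> reduced_words k" "g \<noteq> []" for g
    using asym_occ_Nil_pos[OF that] by (simp add: h_def freq_point_def[of k "\<phi> g"] A[OF that])
  have cont: "continuous_map (freq_space k) euclideanreal (\<lambda>q. h q m v)" if "v \<in> words k m" for m v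
  proof -
    have "A [] q \<noteq> 0" if "q \<in> topspace (freq_space k)" for q
      using pos[OF that] \<epsilon>(1) by simp
    then have "continuous_map (freq_space k) euclideanreal (\<lambda>q. A v q / A [] q)"
      by (intro continuous_map_real_divide cont_A) auto
    then show ?thesis
      using that by (simp add: h_def)
  qed
  have im: "h (freq_point k g) \<in> topspace (freq_space k)" if "g \<in> reduced_words k" "g \<noteq> []" for g
    using h[OF that] auto_nontrivial[OF \<phi> that] by (simp add: freq_point_in_freq_space)
  note im_iff = im[unfolded topspace_freq_space_iff]
  have "h q \<in> topspace (freq_space k)" if q: "q \<in> topspace (freq_space k)" for q
    unfolding topspace_freq_space_iff
  proof (intro conjI allI ballI)
    show "h q m \<in> extensional (words k m)" for m
      by (simp add: h_def)
    show "h q 0 [] = 1"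
      using pos[OF q] \<epsilon>(1) by (simp add: h_def)
    show "0 \<le> h q m v" if "v \<in> words k m" for m v
      using im_iff that by (intro ge_on_freq_space[OF k cont _ q]) auto
    fix m u assume u: "u \<in> words k m"
    show "(\<Sum>x | x \<in> letters k \<and> u @ [x] \<in> words k (Suc m). h q (Suc m) (u @ [x])) = h q m u"
      by (rule eq_on_freq_space[OF k _ _ _ _ q, where Y = euclideanreal])
        (use im_iff u in \<open>auto intro!: continuous_map_sum cont\<close>)
    show "(\<Sum>y | y \<in> letters k \<and> y # u \<in> words k (Suc m). h q (Suc m) (y # u)) = h q m u"
      by (rule eq_on_freq_space[OF k _ _ _ _ q, where Y = euclideanreal])
        (use im_iff u in \<open>auto intro!: continuous_map_sum cont\<close>)
  qed
  then have "continuous_map (freq_space k) (freq_space k) h"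
    using cont by (rule continuous_map_into_freq_space)
  with h that show ?thesis by blast
qed

lemma continuous_extension_iff:
  assumes \<Phi>: "\<Phi> \<in> carrier (Out (free_group k))" "\<phi> \<in> \<Phi>"
  shows "continuous_extension k \<Phi> h \<longleftrightarrow>
    h \<in> extensional (topspace (freq_space k)) \<and> continuous_map (freq_space k) (freq_space k) h \<and>
    (\<forall>g\<in>reduced_words k - {[]}. h (freq_point k g) = freq_point k (\<phi> g))"
  using tilde_freq_point[OF \<Phi>] by (simp add: continuous_extension_def freq_map_image)

lemma ex1_continuous_extension:
  assumes k: "k \<ge> 2" and \<Phi>: "\<Phi> \<in> carrier (Out (free_group k))"
  shows "\<exists>!h. continuous_extension k \<Phi> h"
proof -
  interpret F: group "free_group k" by (rule group_free_group)
  obtain \<phi> where \<phi>: "\<phi> \<in> \<Phi>" "\<phi> \<in> auto (free_group k)"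
    using F.Out_elem(1,2)[OF \<Phi>] by blast
  note iff = continuous_extension_iff[OF \<Phi> \<phi>(1)]
  obtain h where h: "continuous_map (freq_space k) (freq_space k) h"
      "\<And>g. g \<in> reduced_words k \<Longrightarrow> g \<noteq> [] \<Longrightarrow> h (freq_point k g) = freq_point k (\<phi> g)"
    using extension_exists[OF k \<phi>(2)] by blast
  have "continuous_map (freq_space k) (freq_space k) (restrict h (topspace (freq_space k)))"
    by (rule continuous_map_eq[OF h(1)]) simp
  then have "continuous_extension k \<Phi> (restrict h (topspace (freq_space k)))"
    using h(2) by (simp add: iff freq_point_in_freq_space)
  moreover have unique: "h1 = h2" if "continuous_extension k \<Phi> h1" "continuous_extension k \<Phi> h2" for h1 h2
  proof (rule extensionalityI)
    show "h1 q = h2 q" if "q \<in> topspace (freq_space k)" for q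
      by (rule eq_on_freq_space[OF k Hausdorff_freq_space _ _ _ that])
        (use \<open>continuous_extension k \<Phi> h1\<close> \<open>continuous_extension k \<Phi> h2\<close> in \<open>auto simp: iff\<close>)
  qed (use that in \<open>auto simp: iff\<close>)
  ultimately show ?thesis
    by (intro ex1I[of _ "restrict h (topspace (freq_space k))"] unique)
qed

section \<open>Composition law and invertibility of the extended maps\<close>

lemma tilde_ext:
  assumes k: "k \<ge> 2" and \<Phi>: "\<Phi> \<in> carrier (Out (free_group k))"
  shows "continuous_extension k \<Phi> (tilde_ext k \<Phi>)"
  unfolding tilde_ext_def by (rule theI'[OF ex1_continuous_extension[OF k \<Phi>]])

lemma tilde_ext_props:
  assumes k: "k \<ge> 2" and \<Phi>: "\<Phi> \<in> carrier (Out (free_group k))"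
  shows "tilde_ext k \<Phi> \<in> extensional (topspace (freq_space k))"
    and "continuous_map (freq_space k) (freq_space k) (tilde_ext k \<Phi>)"
    and "q \<in> topspace (freq_space k) \<Longrightarrow> tilde_ext k \<Phi> q \<in> topspace (freq_space k)"
    and "\<phi> \<in> \<Phi> \<Longrightarrow> g \<in> reduced_words k \<Longrightarrow> g \<noteq> [] \<Longrightarrow>
      tilde_ext k \<Phi> (freq_point k g) = freq_point k (\<phi> g)"
proof -
  show ext: "tilde_ext k \<Phi> \<in> extensional (topspace (freq_space k))"
    and cont: "continuous_map (freq_space k) (freq_space k) (tilde_ext k \<Phi>)"
    using tilde_ext[OF assms] by (simp_all add: continuous_extension_def)
  show "q \<in> topspace (freq_space k) \<Longrightarrow> tilde_ext k \<Phi> q \<in> topspace (freq_space k)"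
    using continuous_map_image_subset_topspace[OF cont] by auto
  show "tilde_ext k \<Phi> (freq_point k g) = freq_point k (\<phi> g)"
    if "\<phi> \<in> \<Phi>" "g \<in> reduced_words k" "g \<noteq> []"
    using tilde_ext[OF assms] that(2,3) by (simp add: continuous_extension_iff[OF \<Phi> that(1)])
qed

text \<open>Both sides are continuous with values in a Hausdorff space, and on the dense set both
  apply the composite of two representatives to a word.\<close>

lemma tilde_ext_mult:
  assumes k: "k \<ge> 2" and \<Phi>: "\<Phi> \<in> carrier (Out (free_group k))" and \<Psi>: "\<Psi> \<in> carrier (Out (free_group k))"
    and q: "q \<in> topspace (freq_space k)"
  shows "tilde_ext k (\<Phi> \<otimes>\<^bsub>Out (free_group k)\<^esub> \<Psi>) q = tilde_ext k \<Phi> (tilde_ext k \<Psi> q)"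
proof -
  interpret F: group "free_group k" by (rule group_free_group)
  interpret O: group "Out (free_group k)" by (rule F.group_Out)
  obtain \<phi> \<psi> where \<phi>: "\<phi> \<in> \<Phi>" and \<psi>: "\<psi> \<in> \<Psi>" "\<psi> \<in> auto (free_group k)"
    using F.Out_elem(1,2)[OF \<Phi>] F.Out_elem(1,2)[OF \<Psi>] by blast
  note mult = O.m_closed[OF \<Phi> \<Psi>]
  have "tilde_ext k (\<Phi> \<otimes>\<^bsub>Out (free_group k)\<^esub> \<Psi>) q = (tilde_ext k \<Phi> \<circ> tilde_ext k \<Psi>) q"
  proof (rule eq_on_freq_space[OF k Hausdorff_freq_space _ _ _ q])
    show "continuous_map (freq_space k) (freq_space k) (tilde_ext k (\<Phi> \<otimes>\<^bsub>Out (free_group k)\<^esub> \<Psi>))"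
      by (rule tilde_ext_props[OF k mult])
    show "continuous_map (freq_space k) (freq_space k) (tilde_ext k \<Phi> \<circ> tilde_ext k \<Psi>)"
      by (rule continuous_map_compose[OF tilde_ext_props(2)[OF k \<Psi>] tilde_ext_props(2)[OF k \<Phi>]])
    fix g assume g: "g \<in> reduced_words k" "g \<noteq> []"
    show "tilde_ext k (\<Phi> \<otimes>\<^bsub>Out (free_group k)\<^esub> \<Psi>) (freq_point k g) =
        (tilde_ext k \<Phi> \<circ> tilde_ext k \<Psi>) (freq_point k g)"
      using tilde_ext_props(4)[OF k mult F.Out_mult[OF \<Phi> \<Psi> \<phi> \<psi>(1)] g] g
        tilde_ext_props(4)[OF k \<Psi> \<psi>(1) g]
        tilde_ext_props(4)[OF k \<Phi> \<phi> auto_nontrivial[OF \<psi>(2) g]]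
      by (simp add: compose_def)
  qed
  then show ?thesis by simp
qed

lemma tilde_ext_one:
  assumes k: "k \<ge> 2" and q: "q \<in> topspace (freq_space k)"
  shows "tilde_ext k \<one>\<^bsub>Out (free_group k)\<^esub> q = q"
proof -
  interpret F: group "free_group k" by (rule group_free_group)
  interpret O: group "Out (free_group k)" by (rule F.group_Out)
  have "tilde_ext k \<one>\<^bsub>Out (free_group k)\<^esub> q = id q"
    by (rule eq_on_freq_space[OF k Hausdorff_freq_space _ _ _ q])
      (use tilde_ext_props(2)[OF k O.one_closed] tilde_ext_props(4)[OF k O.one_closed F.Out_one] in auto)
  then show ?thesis by simp
qed

lemma tilde_ext_homeomorphic_maps:
  assumes k: "k \<ge> 2" and \<Phi>: "\<Phi> \<in> carrier (Out (free_group k))"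
  shows "homeomorphic_maps (freq_space k) (freq_space k) (tilde_ext k \<Phi>)
    (tilde_ext k (inv\<^bsub>Out (free_group k)\<^esub> \<Phi>))"
proof -
  interpret O: group "Out (free_group k)" by (rule group.group_Out[OF group_free_group])
  show ?thesis
    unfolding homeomorphic_maps_def
    using tilde_ext_props(2)[OF k \<Phi>] tilde_ext_props(2)[OF k O.inv_closed[OF \<Phi>]]
      tilde_ext_mult[OF k \<Phi> O.inv_closed[OF \<Phi>], symmetric] tilde_ext_mult[OF k O.inv_closed[OF \<Phi>] \<Phi>, symmetric]
      \<Phi> tilde_ext_one[OF k]
    by simp
qed

text \<open>The product of \<open>BijGroup\<close> is composition in the usual order, as in
  \<open>AutoGroup\<close>, so a homomorphism into it is a left action.\<close>

lemma tilde_ext_group_action: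
  assumes k: "k \<ge> 2"
  shows "group_action (Out (free_group k)) (topspace (freq_space k)) (tilde_ext k)"
proof -
  let ?E = "topspace (freq_space k)"
  interpret O: group "Out (free_group k)" by (rule group.group_Out[OF group_free_group])
  have Bij: "tilde_ext k \<Phi> \<in> Bij ?E" if \<Phi>: "\<Phi> \<in> carrier (Out (free_group k))" for \<Phi>
  proof -
    have "homeomorphic_map (freq_space k) (freq_space k) (tilde_ext k \<Phi>)"
      using tilde_ext_homeomorphic_maps[OF k \<Phi>] homeomorphic_map_maps by blast
    then have "bij_betw (tilde_ext k \<Phi>) ?E ?E"
      by (simp add: bij_betw_def homeomorphic_imp_injective_map homeomorphic_imp_surjective_map)
    then show ?thesis
      using tilde_ext_props(1)[OF k \<Phi>] by (simp add: Bij_def)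
  qed
  have "tilde_ext k \<in> hom (Out (free_group k)) (BijGroup ?E)"
  proof (rule homI)
    fix \<Phi> \<Psi> assume \<Phi>: "\<Phi> \<in> carrier (Out (free_group k))" and \<Psi>: "\<Psi> \<in> carrier (Out (free_group k))"
    have "tilde_ext k (\<Phi> \<otimes>\<^bsub>Out (free_group k)\<^esub> \<Psi>) = compose ?E (tilde_ext k \<Phi>) (tilde_ext k \<Psi>)"
      using tilde_ext_props(1)[OF k O.m_closed[OF \<Phi> \<Psi>]] tilde_ext_mult[OF k \<Phi> \<Psi>]
      by (intro extensionalityI[of _ ?E]) (simp_all add: compose_eq)
    then show "tilde_ext k (\<Phi> \<otimes>\<^bsub>Out (free_group k)\<^esub> \<Psi>) =
        tilde_ext k \<Phi> \<otimes>\<^bsub>BijGroup ?E\<^esub> tilde_ext k \<Psi>"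
      using Bij[OF \<Phi>] Bij[OF \<Psi>] by (simp add: BijGroup_def)
  qed (simp add: BijGroup_def Bij)
  then show ?thesis
    unfolding group_action_def group_hom_def group_hom_axioms_def
    using group_BijGroup O.is_group by blast
qed

theorem theorem5p6:
  fixes k :: nat
  assumes "k \<ge> 2"
  shows
    "freq_map k ` cyclic_words k \<subseteq> topspace (freq_space k) \<and>
     (\<forall>\<Phi>\<in>carrier (Out (free_group k)).
        (\<forall>w\<in>cyclic_words k. \<forall>w'\<in>cyclic_words k. freq_map k w = freq_map k w' \<longrightarrow>
           freq_map k (cyclic_act k \<Phi> w) = freq_map k (cyclic_act k \<Phi> w')) \<and>
        continuous_map (subtopology (freq_space k) (freq_map k ` cyclic_words k))
          (subtopology (freq_space k) (freq_map k ` cyclic_words k)) (tilde k \<Phi>) \<and>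
        (\<exists>!g. continuous_extension k \<Phi> g) \<and>
        homeomorphic_map (freq_space k) (freq_space k) (tilde_ext k \<Phi>)) \<and>
     group_action (Out (free_group k)) (topspace (freq_space k)) (tilde_ext k)"
proof (intro conjI ballI impI)
  let ?D = "freq_map k ` cyclic_words k"
  interpret F: group "free_group k" by (rule group_free_group)
  show sub: "?D \<subseteq> topspace (freq_space k)"
    unfolding freq_map_image using freq_point_in_freq_space by auto
  show "group_action (Out (free_group k)) (topspace (freq_space k)) (tilde_ext k)"
    by (rule tilde_ext_group_action[OF assms])
  fix \<Phi> assume \<Phi>: "\<Phi> \<in> carrier (Out (free_group k))"
  then obtain \<phi> where \<phi>: "\<phi> \<in> \<Phi>" "\<phi> \<in> auto (free_group k)"
    using F.Out_elem(1,2) by blast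
  show "\<exists>!g. continuous_extension k \<Phi> g"
    by (rule ex1_continuous_extension[OF assms \<Phi>])
  show "homeomorphic_map (freq_space k) (freq_space k) (tilde_ext k \<Phi>)"
    using tilde_ext_homeomorphic_maps[OF assms \<Phi>] homeomorphic_map_maps by blast
  show "freq_map k (cyclic_act k \<Phi> c) = freq_map k (cyclic_act k \<Phi> c')"
    if c: "c \<in> cyclic_words k" "c' \<in> cyclic_words k" "freq_map k c = freq_map k c'" for c c'
  proof -
    obtain w where w: "w \<in> reduced_words k" "w \<noteq> []" "freq_map k c = freq_point k w"
        "freq_map k (cyclic_act k \<Phi> c) = freq_point k (\<phi> w)"
      by (rule cyclic_words_rep[OF c(1)]) (use \<Phi> \<phi> in blast)
    obtain w' where w': "w' \<in> reduced_words k" "w' \<noteq> []" "freq_map k c' = freq_point k w'"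
        "freq_map k (cyclic_act k \<Phi> c') = freq_point k (\<phi> w')"
      by (rule cyclic_words_rep[OF c(2)]) (use \<Phi> \<phi> in blast)
    show ?thesis
      using freq_point_image_cong[OF \<phi>(2) w(1,2) w'(1,2)] w w' c(3) by simp
  qed
  \<comment> \<open>On \<alpha>(C) the map is the restriction of its continuous extension.\<close>
  have "continuous_map (subtopology (freq_space k) ?D) (freq_space k) (tilde k \<Phi>)"
  proof (rule continuous_map_eq[OF continuous_map_from_subtopology[OF tilde_ext_props(2)[OF assms \<Phi>]]])
    fix q assume "q \<in> topspace (subtopology (freq_space k) ?D)"
    then show "tilde_ext k \<Phi> q = tilde k \<Phi> q"
      using tilde_ext[OF assms \<Phi>] by (auto simp: continuous_extension_def)
  qed
  moreover have "tilde k \<Phi> q \<in> ?D" if q: "q \<in> ?D" for q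
  proof -
    obtain g where g: "g \<in> reduced_words k" "g \<noteq> []" "q = freq_point k g"
      using q unfolding freq_map_image by blast
    show ?thesis
      unfolding freq_map_image g(3) tilde_freq_point[OF \<Phi> \<phi>(1) g(1,2)]
      using auto_nontrivial[OF \<phi>(2) g(1,2)] by blast
  qed
  ultimately show "continuous_map (subtopology (freq_space k) ?D) (subtopology (freq_space k) ?D) (tilde k \<Phi>)"
    by (auto simp: continuous_map_in_subtopology)
qed

end
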